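(* Let $X$ be an order continuous Banach lattice and $(E_n)$ an abstract bistochastic filtration on $X$. Let $(z_n)$ be a submartingale relative to $(E_n)$. (1) If $X$ is a KB-space and $\sup_n\|z_n\|<\infty$, then $(z_n)$ is uo-convergent. (2) If a subsequence of $(z_n)$ converges weakly to $x\in X$, then $z_n\xrightarrow{uo}x$.
   Context: A Banach lattice is order continuous if every order null net is norm null, and a KB-space if every norm bounded increasing sequence converges in norm. A filtration $(E_n)_{n\ge1}$ on $X$ is a sequence of positive (linear) projections on $X$ with $E_nE_m=E_mE_n=E_{\min(m,n)}$ for all $m,n\ge1$. It is abstract bistochastic if there exist a weak unit $x_0>0$ in $X$ (i.e. $x\wedge nx_0\uparrow x$ for all $x\ge0$) and a strictly positive order continuous functional $x_0^*>0$ on $X$ (strictly positive: not vanishing on non-zero positive vectors; order continuous: mapping order null nets to order null nets) such that $E_1x_0=x_0$ and $E_1^*x_0^*=x_0^*$ (i.e. $x_0^*\circ E_1=x_0^*$). A sequence $(z_n)\subset X$ is a submartingale relative to $(E_n)$ if $z_n\in\mathrm{Range}(E_n)$ and $E_nz_m\ge z_n$ for all $m\ge n$. A net $(x_\alpha)$ order converges to $x$ ($x_\alpha\xrightarrow{o}x$) if there is a net $(y_\beta)$ (possibly over a different index set) with $y_\beta\downarrow 0$ such that for every $\beta$ there is $\alpha_0$ with $|x_\alpha-x|\le y_\beta$ for all $\alpha\ge\alpha_0$; it uo-converges to $x$ ($x_\alpha\xrightarrow{uo}x$) if $|x_\alpha-x|\wedge y\xrightarrow{o}0$ for all $y\in X_+$.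 *)

theory Defs
  imports
    "HOL-Analysis.Analysis"
    "HOL-Library.Lattice_Algebras"
    "HOL-Library.Lub_Glb"
begin

section \<open>Banach lattices\<close>

class banach_lattice = banach + ordered_real_vector + lattice_ab_group_add_abs +
  assumes norm_mono_abs: "\<bar>x\<bar> \<le> \<bar>y\<bar> \<Longrightarrow> norm x \<le> norm y"

instance real :: banach_lattice
  by standard auto

section \<open>Order convergence and uo-convergence\<close>

text \<open>
  As usual in Isabelle/HOL, a net is a function together with a filter on its index type; a
  sequence is a net along \<^const>\<open>sequentially\<close>.  The dominating net \<open>y\<^sub>\<beta> \<down> 0\<close> in the definition of
  order convergence only matters through its range, which is a nonempty downward directed set with
  infimum \<open>0\<close>; conversely, such a set, indexed by itself with the reversed order, is a
  net decreasing to \<open>0\<close>.  The lemma \<open>order_converges_net_iff\<close> below checks this against the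
  formulation with directed index sets.
\<close>

definition directed_down_to :: "'a::order set \<Rightarrow> 'a \<Rightarrow> bool" where
  "directed_down_to D a \<longleftrightarrow>
     D \<noteq> {} \<and> (\<forall>y\<in>D. \<forall>y'\<in>D. \<exists>y''\<in>D. y'' \<le> y \<and> y'' \<le> y') \<and> isGlb UNIV D a"

definition order_converges ::
    "('i \<Rightarrow> 'a::lattice_ab_group_add_abs) \<Rightarrow> 'a \<Rightarrow> 'i filter \<Rightarrow> bool" where
  "order_converges f x F \<longleftrightarrow>
     (\<exists>D. directed_down_to D 0 \<and> (\<forall>y\<in>D. eventually (\<lambda>i. \<bar>f i - x\<bar> \<le> y) F))"

definition uo_converges ::
    "('i \<Rightarrow> 'a::lattice_ab_group_add_abs) \<Rightarrow> 'a \<Rightarrow> 'i filter \<Rightarrow> bool" where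
  "uo_converges f x F \<longleftrightarrow> (\<forall>y\<ge>0. order_converges (\<lambda>i. inf \<bar>f i - x\<bar> y) 0 F)"

definition directed_index :: "'i set \<Rightarrow> ('i \<Rightarrow> 'i \<Rightarrow> bool) \<Rightarrow> bool" where
  "directed_index A le \<longleftrightarrow>
     A \<noteq> {} \<and> (\<forall>a\<in>A. le a a) \<and>
     (\<forall>a\<in>A. \<forall>b\<in>A. \<forall>c\<in>A. le a b \<longrightarrow> le b c \<longrightarrow> le a c) \<and>
     (\<forall>a\<in>A. \<forall>b\<in>A. \<exists>c\<in>A. le a c \<and> le b c)"

definition tail_filter :: "'i set \<Rightarrow> ('i \<Rightarrow> 'i \<Rightarrow> bool) \<Rightarrow> 'i filter" where
  "tail_filter A le = (INF a\<in>A. principal {b\<in>A. le a b})"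

lemma eventually_tail_filter:
  assumes "directed_index A le"
  shows "eventually P (tail_filter A le) \<longleftrightarrow> (\<exists>a\<in>A. \<forall>b\<in>A. le a b \<longrightarrow> P b)"
  unfolding tail_filter_def
proof (subst eventually_INF_base)
  show "A \<noteq> {}"
    using assms by (simp add: directed_index_def)
next
  fix a b assume ab: "a \<in> A" "b \<in> A"
  then obtain c where c: "c \<in> A" "le a c" "le b c"
    using assms unfolding directed_index_def by meson
  have "{d \<in> A. le c d} \<subseteq> {d \<in> A. le a d} \<inter> {d \<in> A. le b d}"
    using ab c assms unfolding directed_index_def by blast
  then show "\<exists>c\<in>A. principal {d\<in>A. le c d}
      \<le> inf (principal {d\<in>A. le a d}) (principal {d\<in>A. le b d})"
    using c by auto
qed (auto simp: eventually_principal)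

lemma order_convergesI_net:
  fixes y :: "'j \<Rightarrow> 'a::lattice_ab_group_add_abs"
  assumes "directed_index B leB"
    and "\<forall>b\<in>B. \<forall>b'\<in>B. leB b b' \<longrightarrow> y b' \<le> y b"
    and "isGlb UNIV (y ` B) 0"
    and "\<forall>b\<in>B. eventually (\<lambda>i. \<bar>f i - x\<bar> \<le> y b) F"
  shows "order_converges f x F"
proof -
  have "\<exists>w\<in>y ` B. w \<le> u \<and> w \<le> v" if "u \<in> y ` B" "v \<in> y ` B" for u v
  proof -
    obtain a b where "a \<in> B" "b \<in> B" "u = y a" "v = y b"
      using \<open>u \<in> y ` B\<close> \<open>v \<in> y ` B\<close> by blast
    moreover from this obtain c where "c \<in> B" "leB a c" "leB b c"
      using assms(1) unfolding directed_index_def by meson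
    ultimately show ?thesis
      using assms(2) by blast
  qed
  then have "directed_down_to (y ` B) 0"
    using assms(1,3) unfolding directed_down_to_def directed_index_def by blast
  then show ?thesis
    unfolding order_converges_def using assms(4) by blast
qed

lemma order_converges_net_iff:
  fixes f :: "'i \<Rightarrow> 'a::lattice_ab_group_add_abs"
  assumes "directed_index A le"
  shows "order_converges f x (tail_filter A le) \<longleftrightarrow>
    (\<exists>(B::'a set) leB (y::'a \<Rightarrow> 'a). directed_index B leB \<and>
       (\<forall>b\<in>B. \<forall>b'\<in>B. leB b b' \<longrightarrow> y b' \<le> y b) \<and> isGlb UNIV (y ` B) 0 \<and>
       (\<forall>b\<in>B. \<exists>a\<^sub>0\<in>A. \<forall>a\<in>A. le a\<^sub>0 a \<longrightarrow> \<bar>f a - x\<bar> \<le> y b))"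
    (is "?L \<longleftrightarrow> ?R")
proof
  assume ?L
  then obtain D where D: "directed_down_to D 0"
      "\<forall>y\<in>D. eventually (\<lambda>i. \<bar>f i - x\<bar> \<le> y) (tail_filter A le)"
    unfolding order_converges_def by blast
  have "directed_index D (\<ge>)"
    using D(1) unfolding directed_down_to_def directed_index_def by (meson order.refl order.trans)
  moreover have "isGlb UNIV ((\<lambda>y. y) ` D) 0"
    using D(1) by (simp add: directed_down_to_def)
  ultimately show ?R
    using D(2) unfolding eventually_tail_filter[OF assms]
    by (intro exI[of _ D] exI[of _ "(\<ge>)"] exI[of _ "\<lambda>y. y"]) auto
next
  assume ?R
  then show ?L
    unfolding eventually_tail_filter[OF assms, symmetric]
    by (blast intro: order_convergesI_net)
qed

section \<open>Order continuity, KB-spaces and weak convergence\<close>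

text \<open>
  Conditions on all nets in \<open>X\<close> are expressed by quantifying over all filters on \<open>X\<close>: a net
  \<open>f\<close> along \<open>F\<close> corresponds to the identity along \<^term>\<open>filtermap f F\<close>, which removes any
  restriction on the index type (lemmas \<open>order_continuous_normD\<close> and
  \<open>order_continuous_functionalD\<close>).
\<close>

definition order_continuous_norm :: "'a::banach_lattice itself \<Rightarrow> bool" where
  "order_continuous_norm _ \<longleftrightarrow>
     (\<forall>F::'a filter. order_converges (\<lambda>x. x) 0 F \<longrightarrow> ((\<lambda>x. x) \<longlongrightarrow> 0) F)"

definition KB_space :: "'a::banach_lattice itself \<Rightarrow> bool" where
  "KB_space _ \<longleftrightarrow> (\<forall>s::nat \<Rightarrow> 'a. incseq s \<longrightarrow> bounded (range s) \<longrightarrow> convergent s)"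

definition order_continuous_functional :: "('a::banach_lattice \<Rightarrow> real) \<Rightarrow> bool" where
  "order_continuous_functional \<phi> \<longleftrightarrow>
     (\<forall>F::'a filter. order_converges (\<lambda>x. x) 0 F \<longrightarrow> order_converges \<phi> 0 F)"

lemma order_converges_filtermap:
  "order_converges g x (filtermap f F) \<longleftrightarrow> order_converges (\<lambda>i. g (f i)) x F"
  by (simp add: order_converges_def eventually_filtermap)

lemma order_continuous_normD:
  fixes f :: "'i \<Rightarrow> 'a::banach_lattice"
  assumes "order_continuous_norm TYPE('a)" "order_converges f 0 F"
  shows "(f \<longlongrightarrow> 0) F"
  using assms order_converges_filtermap[of "\<lambda>x. x" 0 f F]
  by (auto simp: order_continuous_norm_def filterlim_filtermap)

lemma order_continuous_functionalD:
  fixes f :: "'i \<Rightarrow> 'a::banach_lattice"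
  assumes "order_continuous_functional \<phi>" "order_converges f 0 F"
  shows "order_converges (\<lambda>i. \<phi> (f i)) 0 F"
  using assms order_converges_filtermap[of "\<lambda>x. x" 0 f F] order_converges_filtermap[of \<phi> 0 f F]
  by (auto simp: order_continuous_functional_def)

definition weakly_converges :: "('i \<Rightarrow> 'a::real_normed_vector) \<Rightarrow> 'a \<Rightarrow> 'i filter \<Rightarrow> bool" where
  "weakly_converges f x F \<longleftrightarrow>
     (\<forall>\<phi>::'a \<Rightarrow> real. bounded_linear \<phi> \<longrightarrow> ((\<lambda>i. \<phi> (f i)) \<longlongrightarrow> \<phi> x) F)"

section \<open>Filtrations and submartingales\<close>

text \<open>
  Filtrations and submartingales are indexed by \<open>n \<ge> 1\<close>; the values at index \<open>0\<close> are irrelevant.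
  Continuity is not part of the definition of a positive projection: positive linear
  operators on a Banach lattice are automatically bounded.
\<close>

definition positive_projection :: "('a::banach_lattice \<Rightarrow> 'a) \<Rightarrow> bool" where
  "positive_projection P \<longleftrightarrow> linear P \<and> (\<forall>x\<ge>0. 0 \<le> P x) \<and> P \<circ> P = P"

definition filtration :: "(nat \<Rightarrow> 'a::banach_lattice \<Rightarrow> 'a) \<Rightarrow> bool" where
  "filtration E \<longleftrightarrow>
     (\<forall>n\<ge>1. positive_projection (E n)) \<and>
     (\<forall>m\<ge>1. \<forall>n\<ge>1. E n \<circ> E m = E (min m n) \<and> E m \<circ> E n = E (min m n))"

definition weak_unit :: "'a::banach_lattice \<Rightarrow> bool" where
  "weak_unit e \<longleftrightarrow> 0 < e \<and>
     (\<forall>x\<ge>0. incseq (\<lambda>n. inf x (real n *\<^sub>R e)) \<and> isLub UNIV (range (\<lambda>n. inf x (real n *\<^sub>R e))) x)"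

definition strictly_positive :: "('a::banach_lattice \<Rightarrow> real) \<Rightarrow> bool" where
  "strictly_positive \<phi> \<longleftrightarrow> (\<forall>x\<ge>0. 0 \<le> \<phi> x) \<and> (\<forall>x\<ge>0. x \<noteq> 0 \<longrightarrow> \<phi> x \<noteq> 0)"

definition abstract_bistochastic :: "(nat \<Rightarrow> 'a::banach_lattice \<Rightarrow> 'a) \<Rightarrow> bool" where
  "abstract_bistochastic E \<longleftrightarrow>
     (\<exists>(e::'a) (\<phi>::'a \<Rightarrow> real).
        weak_unit e \<and>
        bounded_linear \<phi> \<and> strictly_positive \<phi> \<and> order_continuous_functional \<phi> \<and>
        E 1 e = e \<and> \<phi> \<circ> E 1 = \<phi>)"

definition submartingale ::
    "(nat \<Rightarrow> 'a::banach_lattice \<Rightarrow> 'a) \<Rightarrow> (nat \<Rightarrow> 'a) \<Rightarrow> bool" where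
  "submartingale E z \<longleftrightarrow>
     (\<forall>n\<ge>1. z n \<in> range (E n)) \<and> (\<forall>n\<ge>1. \<forall>m\<ge>n. z n \<le> E n (z m))"

end

theory Submission
  imports Defs
begin

text \<open>
  The classical proof represents \<open>X\<close> as a space of integrable functions and quotes Doob's convergence
  theorem.  Here Doob's theorem is instead proved inside the lattice, with \<open>\<phi>\<close> as the integral and \<open>e\<close> as
  the constant function one: every \<open>E\<^sub>n\<close> fixes \<open>e\<close> and preserves \<open>\<phi>\<close>, and since \<open>\<phi>\<close> is strictly positive the
  range of \<open>E\<^sub>n\<close> is a sublattice.  The measure of a set on which a sequence is large is replaced by
  expressions such as \<open>\<phi> (inf x e)\<close>.  Uo-convergence of \<open>f\<close> to \<open>x\<close> then follows
  if the elements \<open>inf \<bar>f m - x\<bar> e\<close>, \<open>m \<ge> N\<close>, lie below a common element of arbitrarily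
  small \<open>\<phi>\<close>-value (\<open>unit_limit\<close>, \<open>uo_converges_of_unit_limit\<close>).

  Two estimates carry the proof.  The maximal inequality for positive supermartingales
  (\<open>maximal_inequality\<close>) shows that a supermartingale that is Cauchy for the norm \<open>\<phi> \<bar>x\<bar>\<close> is Cauchy
  in the above sense (\<open>unit_cauchy_of_L1_cauchy\<close>).  A downcrossing estimate (\<open>downcrossing_inequality\<close>) shows that a
  supermartingale with values in an order interval \<open>[0, k e]\<close> is Cauchy for \<open>\<phi> \<bar>x\<bar>\<close>: for each
  level \<open>t\<close> the sequence \<open>\<phi> (inf (v n) (t e))\<close> decreases to a limit, and its increments bound the
  amount by which \<open>v\<close> falls across \<open>t\<close>; finitely many levels suffice.  Truncating at \<open>k e\<close>
  and controlling the excess by the maximal inequality, every positive supermartingale is Cauchy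
  (\<open>positive_supermartingale_unit_cauchy\<close>).

  For the first part, \<open>A n = lim\<^sub>m E\<^sub>n (z\<^sub>m\<^sup>+)\<close> exists in a KB-space, and
  \<open>z = A - (A - z)\<close> is a difference of two positive supermartingales.  The limits of the positive and
  the negative part are obtained as limits inferior, which exist by the KB property and the norm bound.
  For the second part, a weak limit of elements of a convex cone lies in its norm closure.  Hence
  \<open>z n \<le> E\<^sub>n x\<close>, and \<open>x\<close> lies in the closure of the union of the ranges, so \<open>\<phi> \<bar>E\<^sub>n x - x\<bar> \<rightarrow> 0\<close>.
  As \<open>\<phi> (E\<^sub>n x - z n) = \<phi> x - \<phi> (z n)\<close> decreases to \<open>0\<close>, also \<open>\<phi> \<bar>z n - x\<bar> \<rightarrow> 0\<close>, and the maximal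
  inequality upgrades this to uo-convergence.
\<close>

section \<open>Vector lattice identities and the order of a Banach lattice\<close>

text \<open>
  As rewrite rules these four equations push minus signs through \<open>inf\<close> and \<open>sup\<close>, which destroys the
  differences \<open>x - inf x y\<close> on which the arguments below rest.
\<close>

declare neg_inf_eq_sup [simp del] neg_sup_eq_inf [simp del]
  diff_inf_eq_sup [simp del] diff_sup_eq_inf [simp del]

text \<open>
  A lattice-ordered group is a distributive lattice.  If \<open>w\<close> is the left side and \<open>u\<close> the right side,
  the modular identity \<open>t + w = sup t w + inf t w\<close> gives \<open>t \<le> sup x y + (u - w)\<close> for \<open>t = x\<close> and \<open>t = y\<close>,
  hence \<open>0 \<le> u - w\<close>.
\<close>

lemma inf_sup_distrib_le:
  fixes x y z :: "'a::lattice_ab_group_add"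
  shows "inf (sup x y) z \<le> sup (inf x z) (inf y z)"
proof -
  define w where "w = inf (sup x y) z"
  define u where "u = sup (inf x z) (inf y z)"
  have *: "t \<le> sup x y + (u - w)" if "inf t z \<le> u" "t \<le> sup x y" for t
  proof -
    have "inf t w \<le> u"
      by (rule order_trans[OF inf_mono[OF order_refl] that(1)]) (simp add: w_def)
    then have "t + w \<le> sup t w + u"
      by (simp add: add_eq_inf_sup[of t w])
    also have "sup t w \<le> sup x y"
      using that(2) by (simp add: w_def)
    finally show ?thesis
      by (simp add: algebra_simps)
  qed
  have "sup x y \<le> sup x y + (u - w)"
    by (intro sup_least *) (simp_all add: u_def)
  then show ?thesis
    unfolding u_def[symmetric] w_def[symmetric] by simp
qed

lemma pprt_diff_eq: "x - inf x y = pprt (x - y)" for x y :: "'a::lattice_ab_group_add"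
  by (simp add: pprt_def diff_inf_eq_sup add_sup_distrib_left sup_commute)

lemma inf_pprt_pprt_minus: "inf (pprt x) (pprt (- x)) = 0" for x :: "'a::lattice_ab_group_add"
proof -
  have "pprt x - inf (pprt x) (pprt (- x)) = pprt (pprt x - pprt (- x))"
    by (rule pprt_diff_eq)
  also have "pprt x - pprt (- x) = x"
    by (simp add: pprt_neg prts[of x, symmetric])
  finally show ?thesis by simp
qed

lemma scaleR_inf: "0 \<le> c \<Longrightarrow> c *\<^sub>R inf x y = inf (c *\<^sub>R x) (c *\<^sub>R y)"
  for x y :: "'a::banach_lattice"
proof (cases "c = 0")
  case False
  assume "0 \<le> c"
  then have c: "c > 0" using False by simp
  have "inf (c *\<^sub>R x) (c *\<^sub>R y) \<le> c *\<^sub>R inf x y"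
    using c by (simp add: le_inf_iff pos_le_divideR_eq[symmetric] pos_divideR_le_eq
       inf.coboundedI1 inf.coboundedI2 flip: pos_divideR_le_eq)
  moreover have "c *\<^sub>R inf x y \<le> inf (c *\<^sub>R x) (c *\<^sub>R y)"
    using c by (simp add: scaleR_left_mono)
  ultimately show ?thesis by (rule order.antisym[rotated])
qed simp

lemma disjoint_scaleR:
  fixes x y :: "'a::banach_lattice"
  assumes "inf x y = 0" "0 \<le> x" "0 \<le> y" "0 \<le> c"
  shows "inf (c *\<^sub>R x) y = 0"
proof (rule order.antisym)
  define d where "d = max c 1"
  have "inf (c *\<^sub>R x) y \<le> inf (d *\<^sub>R x) (d *\<^sub>R y)"
    using assms scaleR_right_mono[of 1 d y] unfolding d_def
    by (intro inf_mono scaleR_right_mono) auto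
  also have "\<dots> = 0"
    using assms by (simp add: d_def flip: scaleR_inf)
  finally show "inf (c *\<^sub>R x) y \<le> 0" .
qed (use assms in \<open>auto simp: scaleR_nonneg_nonneg\<close>)

lemma inf_add_le:
  fixes a b c :: "'a::lattice_ab_group_add"
  assumes "0 \<le> a" "0 \<le> b" "0 \<le> c"
  shows "inf (a + b) c \<le> inf a c + inf b c"
proof -
  have "c \<le> a + c" "c \<le> c + b" "c \<le> c + c"
    using assms by auto
  then show ?thesis
    by (simp add: add_inf_distrib_left add_inf_distrib_right le_infI1 le_infI2)
qed

lemma abs_inf_diff_le: "\<bar>inf a c - inf b c\<bar> \<le> \<bar>a - b\<bar>" for a b c :: "'a::lattice_ab_group_add_abs"
proof -
  have *: "inf a c \<le> inf b c + \<bar>a - b\<bar>" for a b :: 'a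
  proof -
    have "inf a c \<le> b + \<bar>a - b\<bar>"
      by (metis abs_ge_self add.commute diff_le_eq le_infI1)
    moreover have "inf a c \<le> c + \<bar>a - b\<bar>"
      by (simp add: add_increasing2 le_infI2)
    ultimately show ?thesis by (simp add: add_inf_distrib_right)
  qed
  show ?thesis
    using *[of a b] *[of b a] by (intro abs_leI) (simp_all add: algebra_simps abs_minus_commute)
qed

lemma abs_pprt_diff_le: "\<bar>pprt a - pprt b\<bar> \<le> \<bar>a - b\<bar>" for a b :: "'a::lattice_ab_group_add_abs"
  using abs_inf_diff_le[of "- a" 0 "- b"]
  by (simp add: pprt_def sup_eq_neg_inf[of _ 0] abs_minus_commute)

lemma abs_eq_pprt: "\<bar>x\<bar> = 2 *\<^sub>R pprt x - x" for x :: "'a::banach_lattice"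
proof -
  have "x = pprt x + nprt x" by (rule prts)
  then have "nprt x = x - pprt x" by (metis add_diff_cancel_left')
  then show ?thesis
    unfolding scaleR_2 by (simp add: abs_prts)
qed

lemma double_inf_eq_diff_abs: "inf x y + inf x y = x + y - \<bar>x - y\<bar>" for x y :: "'a::banach_lattice"
proof -
  have "inf x y = x - pprt (x - y)" "inf x y = y - pprt (y - x)"
    using pprt_diff_eq[of x y] pprt_diff_eq[of y x]
    by (simp_all only: inf.commute[of y x] diff_eq_eq eq_diff_eq) (simp_all add: add.commute)
  moreover have "\<bar>x - y\<bar> = pprt (x - y) + pprt (y - x)"
    using pprt_neg[of "x - y"] by (simp add: abs_prts)
  ultimately show ?thesis
    by (metis add_diff_eq diff_add_eq diff_diff_eq2 diff_diff_add add.commute)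
qed

lemma norm_abs_eq [simp]: "norm \<bar>x\<bar> = norm x" for x :: "'a::banach_lattice"
  by (simp add: norm_mono_abs order.antisym)

lemma norm_mono_nonneg: "0 \<le> x \<Longrightarrow> x \<le> y \<Longrightarrow> norm x \<le> norm y" for x y :: "'a::banach_lattice"
  using order_trans by (intro norm_mono_abs) fastforce

lemma tendsto_pprt:
  fixes f :: "'i \<Rightarrow> 'a::banach_lattice"
  assumes "(f \<longlongrightarrow> x) F"
  shows "((\<lambda>i. pprt (f i)) \<longlongrightarrow> pprt x) F"
proof -
  have "norm (pprt (f i) - pprt x) \<le> norm (f i - x)" for i
    by (intro norm_mono_abs abs_pprt_diff_le)
  moreover have "((\<lambda>i. norm (f i - x)) \<longlongrightarrow> 0) F"
    by (rule tendsto_norm_zero[OF LIM_zero[OF assms]])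
  ultimately have "((\<lambda>i. pprt (f i) - pprt x) \<longlongrightarrow> 0) F"
    by (rule Lim_null_comparison[OF always_eventually[OF allI]])
  then show ?thesis
    by (rule LIM_zero_cancel)
qed

lemma tendsto_inf_const:
  fixes f :: "'i \<Rightarrow> 'a::banach_lattice"
  assumes "(f \<longlongrightarrow> x) F"
  shows "((\<lambda>i. inf (f i) c) \<longlongrightarrow> inf x c) F"
proof -
  have "((\<lambda>i. f i - pprt (f i - c)) \<longlongrightarrow> x - pprt (x - c)) F"
    by (intro tendsto_intros tendsto_pprt assms)
  then show ?thesis
    by (simp flip: pprt_diff_eq)
qed

lemma tendsto_nonneg:
  fixes f :: "'i \<Rightarrow> 'a::banach_lattice"
  assumes "(f \<longlongrightarrow> x) F" "F \<noteq> bot" "eventually (\<lambda>i. 0 \<le> f i) F"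
  shows "0 \<le> x"
proof -
  have "((\<lambda>i. pprt (f i)) \<longlongrightarrow> x) F"
    by (rule Lim_transform_eventually[OF assms(1)]) (use assms(3) in eventually_elim, simp)
  then have "x = pprt x"
    using tendsto_pprt[OF assms(1)] assms(2) tendsto_unique by blast
  then show ?thesis
    by (metis zero_le_pprt)
qed

lemma tendsto_le_banach_lattice:
  fixes f :: "'i \<Rightarrow> 'a::banach_lattice"
  assumes "(f \<longlongrightarrow> x) F" "(g \<longlongrightarrow> y) F" "F \<noteq> bot" "eventually (\<lambda>i. f i \<le> g i) F"
  shows "x \<le> y"
  using tendsto_nonneg[OF tendsto_diff[OF assms(2,1)] assms(3)] assms(4) by simp

text \<open>
  The Archimedean property holds because the positive cone is norm closed: \<open>w\<close> lies below
  \<open>u / n\<close>, which tends to \<open>0\<close>.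
\<close>

lemma nonpos_of_bounded_multiples:
  fixes w u :: "'a::banach_lattice"
  assumes "\<And>n::nat. real n *\<^sub>R w \<le> u"
  shows "w \<le> 0"
proof -
  have "(\<lambda>n. inverse (real (Suc n)) *\<^sub>R u) \<longlonglongrightarrow> 0 *\<^sub>R u"
    by (intro tendsto_intros LIMSEQ_inverse_real_of_nat)
  moreover have "w \<le> inverse (real (Suc n)) *\<^sub>R u" for n
    using assms[of "Suc n"] by (simp add: pos_le_divideR_eq del: of_nat_Suc)
  ultimately show ?thesis
    using tendsto_le_banach_lattice[OF tendsto_const, of _ 0 sequentially w] by simp
qed

text \<open>
  An order continuous norm makes bounded increasing sequences converge.  The differences of
  upper bounds \<open>y\<close> and terms \<open>s n\<close> are directed downwards.  A positive lower bound \<open>w\<close> of all of them could be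
  subtracted from every upper bound again and again, against the Archimedean property; so their infimum
  is \<open>0\<close>.  Order continuity produces one difference of small norm, which dominates \<open>s k - s m\<close> for
  \<open>k, m \<ge> n\<close>.
\<close>

lemma incseq_bounded_convergent:
  fixes s :: "nat \<Rightarrow> 'a::banach_lattice"
  assumes oc: "order_continuous_norm TYPE('a)" and s: "incseq s" and u: "\<And>n. s n \<le> u"
  shows "convergent s"
proof -
  define D where "D = {y - s n | y n. \<forall>m. s m \<le> y}"
  have dir: "directed_down_to D 0"
    unfolding directed_down_to_def
  proof (intro conjI ballI)
    show "D \<noteq> {}" using u by (auto simp: D_def)
  next
    fix a b assume "a \<in> D" "b \<in> D"
    then obtain y n y' n' where *: "a = y - s n" "b = y' - s n'" "\<forall>m. s m \<le> y" "\<forall>m. s m \<le> y'"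
      by (auto simp: D_def)
    have "inf y y' - s (max n n') \<in> D"
      using * by (auto simp: D_def)
    moreover have "inf y y' - s (max n n') \<le> a" "inf y y' - s (max n n') \<le> b"
      using s by (auto simp: * incseq_def intro!: diff_mono)
    ultimately show "\<exists>c\<in>D. c \<le> a \<and> c \<le> b" by blast
  next
    have "w \<le> 0" if w: "\<And>d. d \<in> D \<Longrightarrow> w \<le> d" for w
    proof (rule nonpos_of_bounded_multiples)
      \<comment> \<open>subtracting \<open>w\<close> from an upper bound gives an upper bound again\<close>
      have ub: "\<forall>m. s m \<le> u - real n *\<^sub>R w" for n
      proof (induction n)
        case (Suc n)
        have "w \<le> (u - real n *\<^sub>R w) - s m" for m
          using Suc by (intro w) (auto simp: D_def)
        then show ?case by (simp add: algebra_simps)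
      qed (simp add: u)
      show "real n *\<^sub>R w \<le> u - s 0" for n
        using ub[of n] by (simp add: algebra_simps)
    qed
    moreover have "0 \<le> d" if "d \<in> D" for d
      using that by (auto simp: D_def)
    ultimately show "isGlb UNIV D 0"
      by (auto simp: isGlb_def greatestP_def isLb_def setge_def setle_def)
  qed
  then have idx: "directed_index D (\<ge>)"
    unfolding directed_down_to_def directed_index_def by (meson order.refl order.trans)
  have Dpos: "0 \<le> d" if "d \<in> D" for d
    using that by (auto simp: D_def)
  have "order_converges (\<lambda>x. x) 0 (tail_filter D (\<ge>))"
    unfolding order_converges_def eventually_tail_filter[OF idx]
    using dir Dpos by (intro exI[of _ D]) (metis abs_of_nonneg diff_zero)
  then have lim: "((\<lambda>x. x) \<longlongrightarrow> 0) (tail_filter D (\<ge>))"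
    using oc by (simp add: order_continuous_norm_def)
  have "Cauchy s"
  proof (rule CauchyI')
    fix e :: real assume "e > 0"
    then obtain d where d: "d \<in> D" "norm d < e"
      using tendstoD[OF lim] unfolding eventually_tail_filter[OF idx] by fastforce
    then obtain y n where yn: "d = y - s n" "\<forall>m. s m \<le> y" by (auto simp: D_def)
    show "\<exists>M. \<forall>m\<ge>M. \<forall>k>m. dist (s m) (s k) < e"
    proof (intro exI allI impI)
      fix m k assume mk: "m \<ge> n" "k > m"
      have "norm (s k - s m) \<le> norm d"
        using s yn mk by (intro norm_mono_nonneg) (auto simp: incseq_def intro!: diff_mono)
      then show "dist (s m) (s k) < e"
        using d by (simp add: dist_norm norm_minus_commute)
    qed
  qed
  then show ?thesis by (rule Cauchy_convergent)
qed

lemma incseq_tendsto_upper: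
  fixes s :: "nat \<Rightarrow> 'a::banach_lattice"
  assumes "incseq s" "s \<longlonglongrightarrow> x"
  shows "s n \<le> x"
  using assms by (intro tendsto_le_banach_lattice[OF tendsto_const[of "s n"] assms(2)])
     (auto simp: incseq_def eventually_sequentially)

text \<open>
  The distance of \<open>s\<close> from the grid \<open>0, g, \<dots>, J g\<close> is at most \<open>g / 2\<close>, unless \<open>s\<close> lies outside
  the interval \<open>[0, J g]\<close>.  The distance is expressed through its lower bounds \<open>Y\<close>.
\<close>

lemma le_of_le_distance_to_grid:
  fixes s g Y :: "'a::banach_lattice"
  assumes "\<And>i. i \<le> J \<Longrightarrow> Y \<le> \<bar>s - real i *\<^sub>R g\<bar>"
  shows "Y \<le> sup ((1/2) *\<^sub>R g) (sup (s - real J *\<^sub>R g) (- s))"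
  using assms
proof (induction J)
  case 0
  have "Y \<le> sup s (- s)"
    using 0[of 0] by (simp add: abs_lattice)
  also have "\<dots> \<le> sup ((1/2) *\<^sub>R g) (sup (s - real 0 *\<^sub>R g) (- s))"
    unfolding of_nat_0 scaleR_zero_left diff_zero by (rule sup_ge2)
  finally show ?case .
next
  case (Suc J)
  define h where "h = (1/2) *\<^sub>R g"
  define A where "A = sup h (- s)"
  define r where "r = s - real J *\<^sub>R g"
  define B where "B = sup (r - g) (g - r)"
  have r_Suc: "r - g = s - real (Suc J) *\<^sub>R g"
    by (simp add: r_def scaleR_left_distrib)
  have "Y \<le> sup r A"
  proof -
    have "Y \<le> sup h (sup r (- s))"
      unfolding h_def r_def by (rule Suc.IH, rule Suc.prems) simp
    also have "\<dots> \<le> sup r A"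
      unfolding A_def by (intro sup_least) (auto intro: le_supI1 le_supI2)
    finally show ?thesis .
  qed
  moreover have "Y \<le> B"
    using Suc.prems[of "Suc J"] unfolding B_def r_Suc[symmetric] abs_lattice minus_diff_eq by simp
  ultimately have "Y \<le> inf (sup r A) B" by simp
  also have "\<dots> \<le> sup (inf B r) A"
    using inf_sup_distrib_le[of r A B] by (metis inf.commute inf_le1 order_refl order_trans sup_mono)
  also have "sup (inf B r) A \<le> sup (sup (r - g) h) A"
  proof (rule sup_mono[OF _ order_refl])
    \<comment> \<open>\<open>r\<close> and \<open>g - r\<close> are the distances to two neighbouring grid points and add up to \<open>g\<close>\<close>
    have "2 *\<^sub>R inf (g - r) r \<le> g"
      unfolding scaleR_2 using add_mono[of "inf (g - r) r" "g - r" "inf (g - r) r" r] by simp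
    then have "inf (g - r) r \<le> h"
      unfolding h_def using scaleR_left_mono[of "2 *\<^sub>R inf (g - r) r" g "1/2"]
      by (simp only: scaleR_scaleR) simp
    then show "inf B r \<le> sup (r - g) h"
      using inf_sup_distrib_le[of "r - g" "g - r" r] unfolding B_def
      by (meson inf_le1 order_trans sup_mono)
  qed
  also have "\<dots> \<le> sup h (sup (r - g) (- s))"
    unfolding A_def by (intro sup_least) (auto intro: le_supI1 le_supI2)
  finally show ?case
    by (simp only: h_def r_Suc)
qed

lemma abs_positive_linear_le:
  fixes T :: "'a::banach_lattice \<Rightarrow> 'b::banach_lattice"
  assumes lin: "linear T" and pos: "\<And>x. 0 \<le> x \<Longrightarrow> 0 \<le> T x"
  shows "\<bar>T x\<bar> \<le> T \<bar>x\<bar>"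
proof (rule abs_leI)
  have "0 \<le> \<bar>x\<bar> - x"
    unfolding diff_ge_0_iff_ge by (rule abs_ge_self)
  then have "0 \<le> T \<bar>x\<bar> - T x"
    unfolding linear_diff[OF lin, symmetric] by (rule pos)
  then show "T x \<le> T \<bar>x\<bar>"
    unfolding diff_ge_0_iff_ge .
  have "0 \<le> \<bar>x\<bar> + x"
    using abs_ge_minus_self[of x] unfolding diff_0[symmetric] diff_le_eq .
  then have "0 \<le> T \<bar>x\<bar> + T x"
    unfolding linear_add[OF lin, symmetric] by (rule pos)
  then show "- T x \<le> T \<bar>x\<bar>"
    unfolding diff_0[symmetric] diff_le_eq .
qed

text \<open>
  If \<open>T\<close> were unbounded, there would be \<open>y n \<ge> 0\<close> of norm \<open>2 ^ (- n)\<close> whose images have norm above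
  \<open>2 ^ n\<close>.  All of these lie below the convergent sum of the \<open>y n\<close>, whose single image
  would have to dominating_element them.
\<close>

lemma positive_linear_bounded:
  fixes T :: "'a::banach_lattice \<Rightarrow> 'b::banach_lattice"
  assumes lin: "linear T" and pos: "\<And>x. 0 \<le> x \<Longrightarrow> 0 \<le> T x"
  shows "bounded_linear T"
proof -
  have mono: "T x \<le> T y" if "x \<le> y" for x y
    using pos[of "y - x"] that by (simp add: linear_diff[OF lin])
  have "\<exists>B. \<forall>x\<ge>0. norm (T x) \<le> B * norm x"
  proof (rule ccontr)
    assume "\<nexists>B. \<forall>x\<ge>0. norm (T x) \<le> B * norm x"
    then have "\<forall>n::nat. \<exists>x\<ge>0. norm (T x) > 4 ^ n * norm x"
      by (meson not_le)
    then obtain x where x: "\<And>n::nat. 0 \<le> x n" "\<And>n. norm (T (x n)) > 4 ^ n * norm (x n)"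
      by metis
    have x0: "norm (x n) > 0" for n
      using x(2)[of n] linear_0[OF lin] by force
    define y where "y n = (1 / (2 ^ n * norm (x n))) *\<^sub>R x n" for n
    have y: "0 \<le> y n" "norm (y n) = (1/2) ^ n" for n
      using x(1)[of n] x0[of n] by (auto simp: y_def power_divide intro!: scaleR_nonneg_nonneg)
    have ny: "norm (T (y n)) > 2 ^ n" for n
    proof -
      have "(2::real) ^ n * (2 ^ n * norm (x n)) = 4 ^ n * norm (x n)"
        by (simp add: mult.assoc[symmetric] flip: power_mult_distrib)
      then have "2 ^ n * (2 ^ n * norm (x n)) < norm (T (x n))"
        using x(2)[of n] by (simp only:)
      then have "2 ^ n < norm (T (x n)) / (2 ^ n * norm (x n))"
        using x0[of n] by (subst pos_less_divide_eq) auto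
      also have "\<dots> = norm (T (y n))"
        unfolding y_def linear_scale[OF lin] norm_scaleR by simp
      finally show ?thesis .
    qed
    have "summable (\<lambda>n. norm (y n))"
      by (simp add: y(2))
    then have "summable y" by (rule summable_norm_cancel)
    then have lim: "(\<lambda>n. \<Sum>k<n. y k) \<longlonglongrightarrow> suminf y" by (rule summable_LIMSEQ)
    have inc: "incseq (\<lambda>n. \<Sum>k<n. y k)"
      by (intro incseq_SucI) (simp add: y)
    have "y n \<le> suminf y" for n
    proof -
      have "y n \<le> (\<Sum>k<Suc n. y k)"
        using sum_nonneg[of "{..<n}" y] y by simp
      also have "\<dots> \<le> suminf y"
        by (rule incseq_tendsto_upper[OF inc lim])
      finally show ?thesis .
    qed
    then have "norm (T (y n)) \<le> norm (T (suminf y))" for n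
      by (intro norm_mono_nonneg mono pos y)
    moreover obtain n where "norm (T (suminf y)) < 2 ^ n"
      using real_arch_pow[of 2 "norm (T (suminf y))"] by auto
    ultimately show False
      using ny[of n] by (meson not_le less_trans)
  qed
  then obtain B where B: "\<And>x. 0 \<le> x \<Longrightarrow> norm (T x) \<le> B * norm x" by blast
  have "norm (T x) \<le> norm x * B" for x
  proof -
    have "norm (T x) \<le> norm (T \<bar>x\<bar>)"
      using norm_mono_nonneg[OF abs_ge_zero abs_positive_linear_le[OF lin pos, of x]] by simp
    then show ?thesis
      using B[of "\<bar>x\<bar>"] by (simp add: mult.commute)
  qed
  then show ?thesis
    by (intro bounded_linear_intro[of T B] linear_add[OF lin] linear_scale[OF lin])
qed

section \<open>Weak limits in convex cones\<close>

definition sublinear :: "('a::real_vector \<Rightarrow> real) \<Rightarrow> bool" where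
  "sublinear q \<longleftrightarrow> (\<forall>x y. q (x + y) \<le> q x + q y) \<and> (\<forall>c x. 0 \<le> c \<longrightarrow> q (c *\<^sub>R x) = c * q x)"

lemma sublinear_zero: "sublinear q \<Longrightarrow> q 0 = 0"
  unfolding sublinear_def by (metis mult_zero_left order_refl scaleR_zero_left)

lemma sublinear_minus_ge: "sublinear q \<Longrightarrow> - q (- x) \<le> q x"
proof -
  assume q: "sublinear q"
  then have "q (x + - x) \<le> q x + q (- x)" unfolding sublinear_def by blast
  then show ?thesis using sublinear_zero[OF q] by simp
qed

text \<open>
  Lowers a sublinear \<open>q\<close> as far as needed to make \<open>- q y\<close> its value at \<open>- y\<close>; linear
  functionals are those that no tilt lowers.
\<close>

definition tilt :: "('a::real_vector \<Rightarrow> real) \<Rightarrow> 'a \<Rightarrow> 'a \<Rightarrow> real" where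
  "tilt q y x = (INF t\<in>{0..}. q (x + t *\<^sub>R y) - t * q y)"

lemma bdd_below_tilt:
  assumes q: "sublinear q"
  shows "bdd_below ((\<lambda>t. q (x + t *\<^sub>R y) - t * q y) ` {0..})"
proof (rule bdd_belowI2)
  fix t :: real assume "t \<in> {0..}"
  then have "q (t *\<^sub>R y) = t * q y" using q by (auto simp: sublinear_def)
  moreover have "q ((x + t *\<^sub>R y) + (- x)) \<le> q (x + t *\<^sub>R y) + q (- x)"
    using q unfolding sublinear_def by blast
  ultimately show "- q (- x) \<le> q (x + t *\<^sub>R y) - t * q y" by simp
qed

lemma tilt_le: "sublinear q \<Longrightarrow> 0 \<le> t \<Longrightarrow> tilt q y x \<le> q (x + t *\<^sub>R y) - t * q y"
  unfolding tilt_def by (rule cINF_lower[OF bdd_below_tilt]) auto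

lemma le_tilt:
  "(\<And>t. 0 \<le> t \<Longrightarrow> b \<le> q (x + t *\<^sub>R y) - t * q y) \<Longrightarrow> b \<le> tilt q y x"
  unfolding tilt_def by (rule cINF_greatest) auto

lemma sublinearI_pos:
  assumes add: "\<And>x y. q (x + y) \<le> q x + q y" and zero: "q 0 = 0"
    and scale: "\<And>c x. 0 < c \<Longrightarrow> q (c *\<^sub>R x) \<le> c * q x"
  shows "sublinear q"
  unfolding sublinear_def
proof (intro conjI allI impI add)
  fix c x assume c: "0 \<le> (c::real)"
  show "q (c *\<^sub>R x) = c * q x"
  proof (cases "c = 0")
    case False
    then have c: "c > 0" using c by simp
    have "q x = q (inverse c *\<^sub>R (c *\<^sub>R x))" using c by simp
    also have "\<dots> \<le> inverse c * q (c *\<^sub>R x)" using c by (intro scale) simp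
    finally have "c * q x \<le> q (c *\<^sub>R x)" using c by (simp add: field_simps)
    then show ?thesis using scale[OF c, of x] by simp
  qed (simp add: zero)
qed

lemma sublinear_tilt:
  assumes q: "sublinear q"
  shows "sublinear (tilt q y)"
proof (rule sublinearI_pos)
  have qadd: "\<And>x y. q (x + y) \<le> q x + q y" and qscale: "\<And>c x. 0 \<le> c \<Longrightarrow> q (c *\<^sub>R x) = c * q x"
    using q by (auto simp: sublinear_def)
  show "tilt q y (a + b) \<le> tilt q y a + tilt q y b" for a b
  proof -
    have "tilt q y (a + b) - (q (a + s *\<^sub>R y) - s * q y) \<le> tilt q y b" if "0 \<le> s" for s
    proof (rule le_tilt)
      fix t :: real assume "0 \<le> t"
      then have "tilt q y (a + b) \<le> q ((a + b) + (s + t) *\<^sub>R y) - (s + t) * q y"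
        using that by (intro tilt_le q) auto
      also have "(a + b) + (s + t) *\<^sub>R y = (a + s *\<^sub>R y) + (b + t *\<^sub>R y)"
        by (simp add: algebra_simps)
      finally show "tilt q y (a + b) - (q (a + s *\<^sub>R y) - s * q y) \<le> q (b + t *\<^sub>R y) - t * q y"
        using qadd[of "a + s *\<^sub>R y" "b + t *\<^sub>R y"] by (simp add: algebra_simps)
    qed
    then have "tilt q y (a + b) - tilt q y b \<le> tilt q y a"
      by (intro le_tilt) (smt (verit))
    then show ?thesis by simp
  qed
  show "tilt q y 0 = 0"
  proof (rule order.antisym)
    show "tilt q y 0 \<le> 0" using tilt_le[OF q, of 0 y 0] sublinear_zero[OF q] by simp
    show "0 \<le> tilt q y 0" by (rule le_tilt) (simp add: qscale)
  qed
  show "tilt q y (c *\<^sub>R x) \<le> c * tilt q y x" if c: "0 < c" for c x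
  proof -
    have "inverse c * tilt q y (c *\<^sub>R x) \<le> tilt q y x"
    proof (rule le_tilt)
      fix t :: real assume "0 \<le> t"
      then have "tilt q y (c *\<^sub>R x) \<le> q (c *\<^sub>R x + (c * t) *\<^sub>R y) - (c * t) * q y"
        using c by (intro tilt_le q) auto
      also have "c *\<^sub>R x + (c * t) *\<^sub>R y = c *\<^sub>R (x + t *\<^sub>R y)"
        by (simp add: algebra_simps)
      also have "q (c *\<^sub>R (x + t *\<^sub>R y)) = c * q (x + t *\<^sub>R y)"
        using c by (intro qscale) simp
      finally show "inverse c * tilt q y (c *\<^sub>R x) \<le> q (x + t *\<^sub>R y) - t * q y"
        using c by (simp add: field_simps)
    qed
    then show ?thesis using c by (simp add: field_simps)
  qed
qed

lemma tilt_le_self: "sublinear q \<Longrightarrow> tilt q y x \<le> q x"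
  using tilt_le[of q 0 y x] by simp

lemma tilt_minus: "sublinear q \<Longrightarrow> tilt q y (- y) \<le> - q y"
  using tilt_le[of q 1 y "- y"] by (simp add: sublinear_zero)

text \<open>
  The Hahn-Banach theorem in the form of minimal sublinear functionals.  The pointwise infimum of a chain
  of sublinear functionals is sublinear, so there is a minimal one below \<open>tilt p x0\<close>.  It coincides with
  all its tilts, which says that it is additive.  Starting from the tilt at \<open>x0\<close> forces the value
  \<open>p x0\<close> at \<open>x0\<close>.
\<close>

lemma hahn_banach_sublinear:
  fixes p :: "'a::real_vector \<Rightarrow> real"
  assumes p: "sublinear p"
  shows "\<exists>f. linear f \<and> (\<forall>x. f x \<le> p x) \<and> f x0 = p x0"
proof -
  define A where "A = {q. sublinear q \<and> q \<le> tilt p x0}"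
  have p': "tilt p x0 \<in> A"
    by (simp add: A_def sublinear_tilt p)
  have "\<exists>m\<in>A. \<forall>a\<in>A. a \<le> m \<longrightarrow> a = m"
  proof (rule predicate_Zorn)
    show "partial_order_on A (relation_of (\<lambda>q q'. q' \<le> q) A)"
      by (rule partial_order_on_relation_ofI) auto
  next
    fix C assume C: "C \<in> Chains (relation_of (\<lambda>q q'. q' \<le> q) A)"
    show "\<exists>u\<in>A. \<forall>a\<in>C. u \<le> a"
    proof (cases "C = {}")
      case False
      have CA: "q \<in> A" if "q \<in> C" for q
        using C that unfolding Chains_def relation_of_def by auto
      have total: "q \<le> q' \<or> q' \<le> q" if "q \<in> C" "q' \<in> C" for q q'
        using C that unfolding Chains_def relation_of_def by auto
      define u where "u x = (INF q\<in>C. q x)" for x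
      have bdd: "bdd_below ((\<lambda>q. q x) ` C)" for x
      proof (rule bdd_belowI2)
        fix q assume "q \<in> C"
        then have q: "sublinear q" "q (- x) \<le> tilt p x0 (- x)"
          using CA by (auto simp: A_def le_fun_def)
        then show "- tilt p x0 (- x) \<le> q x"
          using sublinear_minus_ge[of q x] by simp
      qed
      have u_le: "u x \<le> q x" if "q \<in> C" for q x
        unfolding u_def by (rule cINF_lower[OF bdd that])
      have le_u: "b \<le> u x" if "\<And>q. q \<in> C \<Longrightarrow> b \<le> q x" for b x
        unfolding u_def using False that by (intro cINF_greatest) auto
      have "sublinear u"
      proof (rule sublinearI_pos)
        show "u (x + y) \<le> u x + u y" for x y
        proof -
          have "u (x + y) \<le> q x + q' y" if "q \<in> C" "q' \<in> C" for q q'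
          proof -
            \<comment> \<open>the smaller of two chain elements serves both arguments\<close>
            define m where "m = (if q \<le> q' then q else q')"
            have m: "m \<in> C" "m x \<le> q x" "m y \<le> q' y"
              using that total[OF that] by (auto simp: m_def le_fun_def)
            have "u (x + y) \<le> m (x + y)" by (rule u_le[OF m(1)])
            also have "\<dots> \<le> m x + m y"
              using CA[OF m(1)] by (auto simp: A_def sublinear_def)
            finally show ?thesis using m by simp
          qed
          then have "u (x + y) - q x \<le> u y" if "q \<in> C" for q
            using that by (intro le_u) (smt (verit))
          then have "u (x + y) - u y \<le> u x"
            by (intro le_u) (smt (verit))
          then show ?thesis by simp
        qed
        have q0: "q 0 = 0" if "q \<in> C" for q
          using CA[OF that] by (simp add: A_def sublinear_zero)
        show "u 0 = 0"
          using False q0 u_le[of _ 0] le_u[of 0 0] by (metis all_not_in_conv order.antisym order_refl)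
        show "u (c *\<^sub>R x) \<le> c * u x" if c: "0 < c" for c x
        proof -
          have "inverse c * u (c *\<^sub>R x) \<le> u x"
          proof (rule le_u)
            fix q assume q: "q \<in> C"
            have "u (c *\<^sub>R x) \<le> c * q x"
              using u_le[OF q, of "c *\<^sub>R x"] CA[OF q] c by (simp add: A_def sublinear_def)
            then show "inverse c * u (c *\<^sub>R x) \<le> q x" using c by (simp add: field_simps)
          qed
          then show ?thesis using c by (simp add: field_simps)
        qed
      qed
      moreover have "u \<le> tilt p x0"
      proof -
        obtain q where q: "q \<in> C" using False by blast
        then show ?thesis
          using u_le[OF q] CA[OF q] unfolding A_def le_fun_def by (auto intro: order_trans)
      qed
      ultimately show ?thesis
        using u_le by (intro bexI[of _ u]) (auto simp: A_def le_fun_def)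
    qed (use p' in auto)
  qed
  then obtain f where f: "f \<in> A" and min: "\<And>a. a \<in> A \<Longrightarrow> a \<le> f \<Longrightarrow> a = f" by blast
  have sub: "sublinear f" and fp: "\<And>x. f x \<le> tilt p x0 x" using f by (auto simp: A_def le_fun_def)
  have tilt_f: "tilt f y = f" for y
  proof (rule min)
    have "tilt f y \<le> f" by (simp add: le_fun_def tilt_le_self sub)
    then show "tilt f y \<in> A" "tilt f y \<le> f"
      using f by (auto simp: A_def sublinear_tilt)
  qed
  have add: "f (x + y) = f x + f y" for x y
  proof (rule order.antisym)
    show "f (x + y) \<le> f x + f y" using sub by (simp add: sublinear_def)
    show "f x + f y \<le> f (x + y)"
      using tilt_le[OF sub, of 1 y x] by (simp add: tilt_f)
  qed
  have neg: "f (- x) = - f x" for x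
    using add[of x "- x"] sublinear_zero[OF sub] by simp
  have "linear f"
  proof (rule linearI)
    show "f (c *\<^sub>R x) = c *\<^sub>R f x" for c x
    proof (cases "0 \<le> c")
      case False
      then have "f ((- c) *\<^sub>R x) = (- c) * f x" using sub unfolding sublinear_def
        by (metis linorder_le_cases neg_0_le_iff_le)
      then show ?thesis using neg[of "c *\<^sub>R x"] by simp
    qed (use sub in \<open>simp add: sublinear_def\<close>)
  qed (rule add)
  moreover have "f x \<le> p x" for x
    using fp[of x] tilt_le_self[OF p, of x0 x] by simp
  moreover have "f x0 = p x0"
    using fp[of "- x0"] tilt_minus[OF p, of x0] neg[of x0] \<open>\<And>x. f x \<le> p x\<close>[of x0] by simp
  ultimately show ?thesis by blast
qed

text \<open>
  Mazur's theorem for cones: the distance to \<open>C\<close> is sublinear, and a linear functional dominated by it is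
  nonpositive on \<open>C\<close>.  Choosing the functional to attain the distance at \<open>x\<close>, weak convergence
  makes this distance nonpositive.
\<close>

lemma weak_limit_in_closure_cone:
  fixes C :: "'a::real_normed_vector set"
  assumes C: "convex_cone C" and x: "weakly_converges f x F" "F \<noteq> bot"
    and ev: "eventually (\<lambda>i. f i \<in> C) F"
  shows "x \<in> closure C"
proof -
  have C0: "0 \<in> C" "C \<noteq> {}" and Cadd: "\<And>a b. a \<in> C \<Longrightarrow> b \<in> C \<Longrightarrow> a + b \<in> C"
    and Cscale: "\<And>a c. a \<in> C \<Longrightarrow> 0 \<le> c \<Longrightarrow> c *\<^sub>R a \<in> C"
    using C by (auto simp: convex_cone_add convex_cone_scaleR convex_cone_contains_0 convex_cone_nonempty)
  define p where "p u = infdist u C" for u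
  have p_le: "p u \<le> norm (u - c)" if "c \<in> C" for u c
    using infdist_le[OF that, of u] by (simp add: p_def dist_norm)
  have le_p: "b \<le> p u" if "\<And>c. c \<in> C \<Longrightarrow> b \<le> norm (u - c)" for u b
    unfolding p_def infdist_notempty[OF C0(2)] dist_norm using C0 that by (intro cINF_greatest) auto
  have p: "sublinear p"
  proof (rule sublinearI_pos)
    show "p (u + v) \<le> p u + p v" for u v
    proof -
      have "p (u + v) \<le> norm (u - c) + norm (v - d)" if "c \<in> C" "d \<in> C" for c d
        using p_le[OF Cadd[OF that], of "u + v"] norm_triangle_ineq[of "u - c" "v - d"]
        by (simp add: algebra_simps)
      then have "p (u + v) - norm (u - c) \<le> p v" if "c \<in> C" for c
        using that by (intro le_p) (smt (verit))
      then have "p (u + v) - p v \<le> p u"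
        by (intro le_p) (smt (verit))
      then show ?thesis by simp
    qed
    show "p 0 = 0" using C0 by (simp add: p_def)
    show "p (c *\<^sub>R u) \<le> c * p u" if c: "0 < c" for c u
    proof -
      have "inverse c * p (c *\<^sub>R u) \<le> p u"
      proof (rule le_p)
        fix d assume "d \<in> C"
        then have "p (c *\<^sub>R u) \<le> norm (c *\<^sub>R u - c *\<^sub>R d)" using c by (intro p_le Cscale) auto
        also have "\<dots> = c * norm (u - d)" using c by (simp flip: scaleR_diff_right)
        finally show "inverse c * p (c *\<^sub>R u) \<le> norm (u - d)" using c by (simp add: field_simps)
      qed
      then show ?thesis using c by (simp add: field_simps)
    qed
  qed
  obtain g where g: "linear g" "\<And>u. g u \<le> p u" "g x = p x"
    using hahn_banach_sublinear[OF p, of x] by blast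
  have g_norm: "g u \<le> norm u" for u
    using g(2)[of u] p_le[OF C0(1), of u] by simp
  have "bounded_linear g"
  proof (rule bounded_linear_intro[where K = 1])
    show "norm (g u) \<le> norm u * 1" for u
      using g_norm[of u] g_norm[of "- u"] by (simp add: linear_neg[OF g(1)])
  qed (simp_all add: linear_add[OF g(1)] linear_scale[OF g(1)])
  then have "((\<lambda>i. g (f i)) \<longlongrightarrow> g x) F"
    using x by (auto simp: weakly_converges_def)
  moreover have "eventually (\<lambda>i. g (f i) \<le> 0) F"
    using ev
  proof eventually_elim
    case (elim i)
    then show ?case using g(2)[of "f i"] p_le[of "f i" "f i"] by simp
  qed
  ultimately have "p x \<le> 0"
    using tendsto_upperbound[OF _ _ x(2)] g(3) by metis
  then have "infdist x C = 0"
    using infdist_nonneg[of x C] by (simp add: p_def)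
  then show ?thesis
    using in_closure_iff_infdist_zero[OF C0(2)] by simp
qed

section \<open>Filtrations with an invariant unit and an invariant functional\<close>

locale bistochastic_filtration =
  fixes E :: "nat \<Rightarrow> 'a::banach_lattice \<Rightarrow> 'a" and e :: 'a and \<phi> :: "'a \<Rightarrow> real"
  assumes oc: "order_continuous_norm TYPE('a)"
    and filtration: "filtration E"
    and unit: "weak_unit e"
    and phi_bounded: "bounded_linear \<phi>"
    and phi_strict: "strictly_positive \<phi>"
    and E1_unit: "E 1 e = e"
    and phi_E1: "\<phi> \<circ> E 1 = \<phi>"
begin

lemma phi_linear: "linear \<phi>"
  using phi_bounded by (rule bounded_linear.linear)

lemmas phi_add = linear_add[OF phi_linear]
  and phi_diff = linear_diff[OF phi_linear]
  and phi_scaleR = linear_scale[OF phi_linear]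
  and phi_sum = linear_sum[OF phi_linear]

lemma phi_nonneg: "0 \<le> x \<Longrightarrow> 0 \<le> \<phi> x"
  using phi_strict by (simp add: strictly_positive_def)

lemma phi_mono: "x \<le> y \<Longrightarrow> \<phi> x \<le> \<phi> y"
  using phi_nonneg[of "y - x"] by (simp add: phi_diff)

lemma phi_eq_0: "0 \<le> x \<Longrightarrow> \<phi> x \<le> 0 \<Longrightarrow> x = 0"
  using phi_strict phi_nonneg[of x] unfolding strictly_positive_def by fastforce

lemma phi_abs_triangle: "\<phi> \<bar>x + y\<bar> \<le> \<phi> \<bar>x\<bar> + \<phi> \<bar>y\<bar>"
  using phi_mono[OF abs_triangle_ineq[of x y]] by (simp add: phi_add)

lemma phi_le_abs: "\<phi> x \<le> \<phi> \<bar>x\<bar>"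
  by (rule phi_mono[OF abs_ge_self])

lemma tendsto_phi: "(f \<longlongrightarrow> x) F \<Longrightarrow> ((\<lambda>i. \<phi> (f i)) \<longlongrightarrow> \<phi> x) F"
  by (rule bounded_linear.tendsto[OF phi_bounded])

lemma e_nonneg: "0 \<le> e"
  using unit by (auto simp: weak_unit_def)

lemma ce_nonneg: "0 \<le> c \<Longrightarrow> 0 \<le> c *\<^sub>R e"
  by (intro scaleR_nonneg_nonneg e_nonneg)

lemma E_linear: "1 \<le> n \<Longrightarrow> linear (E n)"
  using filtration by (simp add: filtration_def positive_projection_def)

lemma E_nonneg: "1 \<le> n \<Longrightarrow> 0 \<le> x \<Longrightarrow> 0 \<le> E n x"
  using filtration by (simp add: filtration_def positive_projection_def)

lemma E_add: "1 \<le> n \<Longrightarrow> E n (x + y) = E n x + E n y"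
  and E_diff: "1 \<le> n \<Longrightarrow> E n (x - y) = E n x - E n y"
  and E_scaleR: "1 \<le> n \<Longrightarrow> E n (c *\<^sub>R x) = c *\<^sub>R E n x"
  and E_minus: "1 \<le> n \<Longrightarrow> E n (- x) = - E n x"
  by (simp_all add: E_linear linear_add linear_diff linear_scale linear_neg)

lemma E_mono: "1 \<le> n \<Longrightarrow> x \<le> y \<Longrightarrow> E n x \<le> E n y"
  using E_nonneg[of n "y - x"] by (simp add: E_diff)

lemma E_E: "1 \<le> n \<Longrightarrow> 1 \<le> m \<Longrightarrow> E n (E m x) = E (min m n) x"
  using filtration unfolding filtration_def by (metis comp_apply)

lemma E_E_le: "1 \<le> n \<Longrightarrow> n \<le> m \<Longrightarrow> E n (E m x) = E n x"
  by (simp add: E_E min_def)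

lemma E_unit: "1 \<le> n \<Longrightarrow> E n e = e"
  using E_E[of n 1 e] by (simp add: E1_unit[unfolded One_nat_def] min_def)

lemma phi_E: "1 \<le> n \<Longrightarrow> \<phi> (E n x) = \<phi> x"
  using E_E[of 1 n x] phi_E1 by (metis comp_apply le_refl min.absorb2)

lemma abs_E_le: "1 \<le> n \<Longrightarrow> \<bar>E n x\<bar> \<le> E n \<bar>x\<bar>"
  by (intro abs_positive_linear_le E_linear E_nonneg)

lemma phi_abs_E_le: "1 \<le> n \<Longrightarrow> \<phi> \<bar>E n x\<bar> \<le> \<phi> \<bar>x\<bar>"
  using phi_mono[OF abs_E_le[of n x]] by (simp add: phi_E)

lemma E_bounded: "1 \<le> n \<Longrightarrow> bounded_linear (E n)"
  by (intro positive_linear_bounded E_linear E_nonneg)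

text \<open>
  Since \<open>\<phi>\<close> is strictly positive and invariant, a fixed point inequality is an equality.  Applied to
  suprema, it shows that the range of \<open>E n\<close> is a sublattice.
\<close>

lemma E_fix_le:
  assumes "1 \<le> n" "x \<le> E n x"
  shows "E n x = x"
  using phi_eq_0[of "E n x - x"] assms by (simp add: phi_diff phi_E)

lemma E_fix_sup:
  assumes "1 \<le> n" "E n x = x" "E n y = y"
  shows "E n (sup x y) = sup x y"
proof (rule E_fix_le)
  show "sup x y \<le> E n (sup x y)"
    using E_mono[of n x "sup x y"] E_mono[of n y "sup x y"] assms by simp
qed fact

lemma E_fix_pprt: "1 \<le> n \<Longrightarrow> E n x = x \<Longrightarrow> E n (pprt x) = pprt x"
  unfolding pprt_def by (intro E_fix_sup) (simp_all add: E_linear linear_0)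

lemma E_fix_inf:
  assumes n: "1 \<le> n" and "E n x = x" "E n y = y"
  shows "E n (inf x y) = inf x y"
proof -
  have "E n (sup (- x) (- y)) = sup (- x) (- y)"
    by (rule E_fix_sup[OF n]) (simp_all add: E_minus[OF n] assms)
  then show ?thesis
    unfolding inf_eq_neg_sup[of x y] E_minus[OF n] by (rule arg_cong)
qed

text \<open>
  The finite horizon is needed for auxiliary processes that involve the final value \<open>v K\<close>.
\<close>

definition supermartingale_on :: "nat \<Rightarrow> nat \<Rightarrow> (nat \<Rightarrow> 'a) \<Rightarrow> bool" where
  "supermartingale_on N K v \<longleftrightarrow> 1 \<le> N \<and> (\<forall>n\<in>{N..K}. E n (v n) = v n) \<and>
     (\<forall>n\<in>{N..K}. \<forall>m\<in>{n..K}. E n (v m) \<le> v n)"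

definition supermartingale :: "(nat \<Rightarrow> 'a) \<Rightarrow> bool" where
  "supermartingale v \<longleftrightarrow> (\<forall>n\<ge>1. E n (v n) = v n) \<and> (\<forall>n\<ge>1. \<forall>m\<ge>n. E n (v m) \<le> v n)"

lemma supermartingale_onI: "supermartingale v \<Longrightarrow> 1 \<le> N \<Longrightarrow> supermartingale_on N K v"
  by (auto simp: supermartingale_def supermartingale_on_def)

lemma phi_supermartingale_le:
  "supermartingale v \<Longrightarrow> 1 \<le> n \<Longrightarrow> n \<le> m \<Longrightarrow> \<phi> (v m) \<le> \<phi> (v n)"
  unfolding supermartingale_def by (metis phi_E phi_mono)

section \<open>The maximal inequality\<close>

text \<open>
  One step of the backward induction for the maximal inequality.  With \<open>A = inf (pprt (w - c e)) e\<close>, the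
  difference \<open>r\<close> of the two sides satisfies \<open>r \<le> c e - w\<close>, because \<open>A\<close> and \<open>B\<close> lie below \<open>e\<close>, and
  \<open>r \<le> c A\<close>, because \<open>sup A B \<le> A + B\<close>.  These two bounds have disjoint positive parts,
  so \<open>r \<le> 0\<close>.  This replaces the case distinction whether \<open>w\<close> exceeds the level \<open>c\<close>.
\<close>

lemma maximal_inequality_step:
  assumes n: "1 \<le> n" and w: "E n w = w" "0 \<le> w" and B: "0 \<le> B" "B \<le> e" "c *\<^sub>R E n B \<le> w"
    and c: "0 < c"
  shows "c *\<^sub>R E n (sup (inf (pprt (w - c *\<^sub>R e)) e) B) \<le> w"
proof -
  define A where "A = inf (pprt (w - c *\<^sub>R e)) e"
  have A: "0 \<le> A" "A \<le> e" using e_nonneg by (simp_all add: A_def)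
  have EA: "E n A = A"
    unfolding A_def using n w by (intro E_fix_inf E_fix_pprt) (simp_all add: E_diff E_scaleR E_unit)
  define r where "r = c *\<^sub>R E n (sup A B) - w"
  have "E n (sup A B) \<le> e"
    using E_mono[OF n, of "sup A B" e] A B by (simp add: E_unit[OF n])
  then have "r \<le> c *\<^sub>R e - w"
    using c by (simp add: r_def scaleR_left_mono)
  then have r1: "r \<le> pprt (- (w - c *\<^sub>R e))"
    by (simp add: pprt_def le_supI1)
  have "E n (sup A B) \<le> A + E n B"
    using E_mono[OF n, of "sup A B" "A + B"] A B by (simp add: EA E_add[OF n])
  then have "c *\<^sub>R E n (sup A B) \<le> c *\<^sub>R A + c *\<^sub>R E n B"
    using c scaleR_left_mono[of "E n (sup A B)" "A + E n B" c] by (simp add: scaleR_right_distrib)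
  then have "r \<le> c *\<^sub>R A"
    using add_left_mono[OF B(3), of "c *\<^sub>R A"] unfolding r_def diff_le_eq by (rule order_trans)
  also have "\<dots> \<le> c *\<^sub>R pprt (w - c *\<^sub>R e)"
    using c by (intro scaleR_left_mono) (simp_all add: A_def)
  finally have r2: "r \<le> c *\<^sub>R pprt (w - c *\<^sub>R e)" .
  have "r \<le> inf (c *\<^sub>R pprt (w - c *\<^sub>R e)) (pprt (- (w - c *\<^sub>R e)))"
    using r1 r2 by (rule inf_greatest[rotated])
  also have "\<dots> = 0"
    using c by (intro disjoint_scaleR inf_pprt_pprt_minus) simp_all
  finally show ?thesis by (simp add: r_def A_def)
qed

text \<open>
  For random variables, \<open>c\<close> times the probability of \<open>sup w > c\<close> is at most the expectation of
  \<open>w N\<close>.  Here \<open>inf (pprt (G - c e)) e\<close>, with \<open>G\<close> the supremum, stands for the indicator of this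
  event; it lies below the indicator, and it has the same support.
\<close>

lemma maximal_inequality:
  assumes w: "supermartingale_on N K w" "\<And>n. n \<in> {N..K} \<Longrightarrow> 0 \<le> w n" and NK: "N \<le> K" and c: "0 < c"
  shows "c *\<^sub>R E N (inf (pprt (Sup_fin (w ` {N..K}) - c *\<^sub>R e)) e) \<le> w N"
proof -
  have N: "1 \<le> N" and fixE: "\<And>n. n \<in> {N..K} \<Longrightarrow> E n (w n) = w n"
    and dec: "\<And>n m. n \<in> {N..K} \<Longrightarrow> m \<in> {n..K} \<Longrightarrow> E n (w m) \<le> w n"
    using w(1) by (auto simp: supermartingale_on_def)
  define H where "H n = inf (pprt (Sup_fin (w ` {n..K}) - c *\<^sub>R e)) e" for n
  have H: "0 \<le> H n" "H n \<le> e" for n using e_nonneg by (simp_all add: H_def)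
  have "c *\<^sub>R E N (H N) \<le> w N"
    using NK
  proof (induction rule: inc_induct)
    case base
    \<comment> \<open>the last time is an induction step with nothing after it\<close>
    have "c *\<^sub>R E K (sup (inf (pprt (w K - c *\<^sub>R e)) e) 0) \<le> w K"
      using N NK fixE[of K] w(2)[of K] e_nonneg c
      by (intro maximal_inequality_step) (auto simp: E_linear linear_0)
    moreover have "sup (inf (pprt (w K - c *\<^sub>R e)) e) 0 = H K"
      using e_nonneg by (simp add: H_def sup_absorb1)
    ultimately show ?case by simp
  next
    case (step n)
    have n: "1 \<le> n" "n \<in> {N..K}" "Suc n \<in> {n..K}" using step N by auto
    have set: "{n..K} = insert n {Suc n..K}" using step by auto
    have "Sup_fin (w ` {n..K}) = sup (w n) (Sup_fin (w ` {Suc n..K}))"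
      unfolding set image_insert using step by (intro Sup_fin.insert) auto
    then have "pprt (Sup_fin (w ` {n..K}) - c *\<^sub>R e)
        = sup (pprt (w n - c *\<^sub>R e)) (pprt (Sup_fin (w ` {Suc n..K}) - c *\<^sub>R e))"
      using add_sup_distrib_right[of "w n" "Sup_fin (w ` {Suc n..K})" "- c *\<^sub>R e"]
      by (simp add: pprt_def sup_aci)
    then have "H n \<le> sup (inf (pprt (w n - c *\<^sub>R e)) e) (H (Suc n))"
      unfolding H_def by (simp add: inf_sup_distrib_le)
    then have "c *\<^sub>R E n (H n) \<le> c *\<^sub>R E n (sup (inf (pprt (w n - c *\<^sub>R e)) e) (H (Suc n)))"
      using c n by (intro scaleR_left_mono E_mono) auto
    also have "\<dots> \<le> w n"
    proof (intro maximal_inequality_step)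
      have "c *\<^sub>R E n (H (Suc n)) = E n (c *\<^sub>R E (Suc n) (H (Suc n)))"
        using n by (simp add: E_scaleR E_E_le)
      also have "\<dots> \<le> E n (w (Suc n))"
        using step.IH n by (intro E_mono) auto
      also have "\<dots> \<le> w n" using n by (intro dec)
      finally show "c *\<^sub>R E n (H (Suc n)) \<le> w n" .
    qed (use n fixE w(2) H c in auto)
    finally show ?case .
  qed
  then show ?thesis by (simp add: H_def)
qed

lemma maximal_phi:
  assumes w: "supermartingale_on N K w" "\<And>n. n \<in> {N..K} \<Longrightarrow> 0 \<le> w n" and NK: "N \<le> K" and c: "0 < c"
  shows "\<phi> (inf (pprt (Sup_fin (w ` {N..K}) - c *\<^sub>R e)) e) \<le> \<phi> (w N) / c"
    and "\<phi> (inf (Sup_fin (w ` {N..K})) e) \<le> c * \<phi> e + \<phi> (w N) / c"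
proof -
  define G where "G = Sup_fin (w ` {N..K})"
  have N: "1 \<le> N" using w(1) by (simp add: supermartingale_on_def)
  show *: "\<phi> (inf (pprt (Sup_fin (w ` {N..K}) - c *\<^sub>R e)) e) \<le> \<phi> (w N) / c"
    using phi_mono[OF maximal_inequality[OF assms]] c N
    by (simp add: phi_scaleR phi_E pos_le_divide_eq mult.commute)
  have "G \<le> c *\<^sub>R e + pprt (G - c *\<^sub>R e)"
    unfolding pprt_def by (simp add: add_sup_distrib_left)
  then have "inf G e \<le> inf (c *\<^sub>R e + pprt (G - c *\<^sub>R e)) e"
    by (rule inf_mono) simp
  also have "\<dots> \<le> inf (c *\<^sub>R e) e + inf (pprt (G - c *\<^sub>R e)) e"
    using c by (intro inf_add_le ce_nonneg e_nonneg) auto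
  also have "\<dots> \<le> c *\<^sub>R e + inf (pprt (G - c *\<^sub>R e)) e"
    by (rule add_right_mono) simp
  finally have "\<phi> (inf G e) \<le> c * \<phi> e + \<phi> (inf (pprt (G - c *\<^sub>R e)) e)"
    using phi_mono by (fastforce simp: phi_add phi_scaleR)
  then show "\<phi> (inf (Sup_fin (w ` {N..K})) e) \<le> c * \<phi> e + \<phi> (w N) / c"
    using * by (simp add: G_def)
qed

text \<open>
  The increments \<open>\<bar>v m - v N\<bar>\<close> are dominated by
  \<open>W m = (v m - E m (v K)) + E m \<bar>v K - v N\<bar>\<close>, a positive supermartingale up to the horizon \<open>K\<close>, to which the
  maximal inequality applies.
\<close>

lemma supermartingale_fluctuation:
  assumes v: "supermartingale_on N K v" and NK: "N \<le> K" and c: "0 < c"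
  shows "\<phi> (inf (Sup_fin ((\<lambda>m. \<bar>v m - v N\<bar>) ` {N..K})) e) \<le> c * \<phi> e + 2 * \<phi> \<bar>v K - v N\<bar> / c"
proof -
  have N: "1 \<le> N" and fixE: "\<And>n. n \<in> {N..K} \<Longrightarrow> E n (v n) = v n"
    and dec: "\<And>n m. n \<in> {N..K} \<Longrightarrow> m \<in> {n..K} \<Longrightarrow> E n (v m) \<le> v n"
    using v by (auto simp: supermartingale_on_def)
  define W where "W m = (v m - E m (v K)) + E m \<bar>v K - v N\<bar>" for m
  have sW: "supermartingale_on N K W"
    unfolding supermartingale_on_def
  proof (intro conjI ballI N)
    fix n assume n: "n \<in> {N..K}"
    then have n1: "1 \<le> n" using N by simp
    show "E n (W n) = W n"
      using n n1 by (simp add: W_def E_add E_diff E_E_le fixE)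
    fix m assume m: "m \<in> {n..K}"
    show "E n (W m) \<le> W n"
      using dec[OF n m] m n1 by (simp add: W_def E_add E_diff E_E_le)
  qed
  have W: "\<bar>v m - v N\<bar> \<le> W m" if m: "m \<in> {N..K}" for m
  proof -
    have m1: "1 \<le> m" using m N by simp
    have "E m (v N) = v N"
      using E_E[of m N "v N"] m N m1 fixE[of N] NK by (simp add: min_def split: if_splits)
    then have "v m - v N = (v m - E m (v K)) + E m (v K - v N)"
      by (simp add: E_diff[OF m1])
    then have "\<bar>v m - v N\<bar> \<le> \<bar>v m - E m (v K)\<bar> + \<bar>E m (v K - v N)\<bar>"
      using abs_triangle_ineq by metis
    also have "\<bar>v m - E m (v K)\<bar> = v m - E m (v K)"
      using dec[OF m, of K] m by (intro abs_of_nonneg) simp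
    finally show ?thesis
      unfolding W_def using abs_E_le[OF m1] by (meson add_left_mono order_trans)
  qed
  have W0: "0 \<le> W m" if "m \<in> {N..K}" for m
    using W[OF that] abs_ge_zero order_trans by blast
  have "Sup_fin ((\<lambda>m. \<bar>v m - v N\<bar>) ` {N..K}) \<le> Sup_fin (W ` {N..K})"
  proof (rule Sup_fin.boundedI)
    fix x assume "x \<in> (\<lambda>m. \<bar>v m - v N\<bar>) ` {N..K}"
    then obtain m where m: "m \<in> {N..K}" "x = \<bar>v m - v N\<bar>" by blast
    have "W m \<le> Sup_fin (W ` {N..K})" using m by (intro Sup_fin.coboundedI) auto
    then show "x \<le> Sup_fin (W ` {N..K})" using W[OF m(1)] m(2) order_trans by blast
  qed (use NK in auto)
  then have "\<phi> (inf (Sup_fin ((\<lambda>m. \<bar>v m - v N\<bar>) ` {N..K})) e) \<le> \<phi> (inf (Sup_fin (W ` {N..K})) e)"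
    by (intro phi_mono inf_mono order_refl)
  also have "\<dots> \<le> c * \<phi> e + \<phi> (W N) / c"
    by (rule maximal_phi(2)[OF sW W0 NK c])
  also have "\<phi> (W N) \<le> 2 * \<phi> \<bar>v K - v N\<bar>"
    using N phi_le_abs[of "v N - v K"]
    by (simp add: W_def phi_add phi_diff phi_E abs_minus_commute)
  finally show ?thesis using c by (simp add: divide_right_mono)
qed

text \<open>
  The truncated finite suprema increase and are bounded by \<open>e\<close>, so they converge to an
  element that bounds all terms at once.
\<close>

lemma dominating_element:
  fixes N :: nat
  assumes "\<And>K. N \<le> K \<Longrightarrow> \<phi> (inf (Sup_fin (g ` {N..K})) e) \<le> \<eta>"
  shows "\<exists>h. \<phi> h \<le> \<eta> \<and> (\<forall>m\<ge>N. inf (g m) e \<le> h)"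
proof -
  define s where "s j = inf (Sup_fin (g ` {N..N + j})) e" for j
  have "incseq s"
  proof (rule incseq_SucI)
    fix j
    have "Sup_fin (g ` {N..N + j}) \<le> Sup_fin (g ` {N..N + Suc j})"
      by (rule Sup_fin.subset_imp) auto
    then show "s j \<le> s (Suc j)" unfolding s_def by (rule inf_mono) simp
  qed
  moreover have "s j \<le> e" for j by (simp add: s_def)
  ultimately obtain h where h: "s \<longlonglongrightarrow> h"
    using incseq_bounded_convergent[OF oc] unfolding convergent_def by metis
  have "\<phi> (s j) \<le> \<eta>" for j using assms[of "N + j"] by (simp add: s_def)
  then have "\<phi> h \<le> \<eta>"
    using tendsto_upperbound[OF tendsto_phi[OF h]] by simp
  moreover have "inf (g m) e \<le> h" if "N \<le> m" for m
  proof -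
    have "g m \<le> Sup_fin (g ` {N..m})" using that by (intro Sup_fin.coboundedI) auto
    then have "inf (g m) e \<le> s (m - N)"
      using that unfolding s_def by (intro inf_mono) auto
    also have "\<dots> \<le> h" by (rule incseq_tendsto_upper[OF \<open>incseq s\<close> h])
    finally show ?thesis .
  qed
  ultimately show ?thesis by blast
qed

section \<open>Convergence modulo truncation at the unit\<close>

text \<open>
  A quantitative form of uo-convergence: \<open>N\<close> and \<open>h\<close> play the role of the exceptional set in almost
  uniform convergence.
\<close>

definition unit_limit :: "(nat \<Rightarrow> 'a) \<Rightarrow> 'a \<Rightarrow> bool" where
  "unit_limit f x \<longleftrightarrow> (\<forall>\<eta>>0. \<exists>N h. \<phi> h \<le> \<eta> \<and> (\<forall>m\<ge>N. inf \<bar>f m - x\<bar> e \<le> h))"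

definition unit_cauchy :: "(nat \<Rightarrow> 'a) \<Rightarrow> bool" where
  "unit_cauchy f \<longleftrightarrow> (\<forall>\<eta>>0. \<exists>N h. \<phi> h \<le> \<eta> \<and> (\<forall>m\<ge>N. \<forall>n\<ge>N. inf \<bar>f m - f n\<bar> e \<le> h))"

lemma inf_abs_add_le: "inf \<bar>x + y\<bar> e \<le> inf \<bar>x\<bar> e + inf \<bar>y\<bar> e"
proof -
  have "inf \<bar>x + y\<bar> e \<le> inf (\<bar>x\<bar> + \<bar>y\<bar>) e"
    by (rule inf_mono[OF abs_triangle_ineq order_refl])
  also have "\<dots> \<le> inf \<bar>x\<bar> e + inf \<bar>y\<bar> e"
    by (intro inf_add_le abs_ge_zero e_nonneg)
  finally show ?thesis .
qed

text \<open>
  The fluctuation bound \<open>c \<phi>(e) + 2 \<phi> \<bar>v K - v N\<bar> / c\<close> does not depend on the horizon \<open>K\<close> if the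
  supermartingale is Cauchy, and \<open>c\<close> is free.
\<close>

lemma unit_cauchy_of_L1_cauchy:
  assumes v: "supermartingale v"
    and L1: "\<And>\<eta>. 0 < \<eta> \<Longrightarrow> \<exists>N. \<forall>m\<ge>N. \<forall>n\<ge>N. \<phi> \<bar>v m - v n\<bar> \<le> \<eta>"
  shows "unit_cauchy v"
  unfolding unit_cauchy_def
proof (intro allI impI)
  fix \<eta> :: real assume \<eta>: "0 < \<eta>"
  \<comment> \<open>both terms of the fluctuation bound are at most \<open>\<eta> / 4\<close>; adding 1 keeps the denominator positive\<close>
  define c where "c = \<eta> / (4 * (\<phi> e + 1))"
  have e: "0 \<le> \<phi> e" by (intro phi_nonneg e_nonneg)
  then have c: "0 < c" "c * \<phi> e \<le> \<eta> / 4"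
    using \<eta> by (simp_all add: c_def field_simps)
  have "0 < c * \<eta> / 8" using c \<eta> by simp
  then obtain N0 where N0: "\<And>m n. N0 \<le> m \<Longrightarrow> N0 \<le> n \<Longrightarrow> \<phi> \<bar>v m - v n\<bar> \<le> c * \<eta> / 8"
    using L1 by blast
  define N where "N = max N0 1"
  have "\<exists>h. \<phi> h \<le> \<eta> / 2 \<and> (\<forall>m\<ge>N. inf \<bar>v m - v N\<bar> e \<le> h)"
  proof (rule dominating_element)
    fix K assume K: "N \<le> K"
    have "\<phi> (inf (Sup_fin ((\<lambda>m. \<bar>v m - v N\<bar>) ` {N..K})) e) \<le> c * \<phi> e + 2 * \<phi> \<bar>v K - v N\<bar> / c"
      using c K v by (intro supermartingale_fluctuation supermartingale_onI) (auto simp: N_def)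
    also have "2 * \<phi> \<bar>v K - v N\<bar> / c \<le> 2 * (c * \<eta> / 8) / c"
      using N0[of K N] K c by (intro divide_right_mono mult_left_mono) (auto simp: N_def)
    also have "\<dots> = \<eta> / 4" using c by simp
    finally show "\<phi> (inf (Sup_fin ((\<lambda>m. \<bar>v m - v N\<bar>) ` {N..K})) e) \<le> \<eta> / 2"
      using c(2) by simp
  qed
  then obtain h where h: "\<phi> h \<le> \<eta> / 2" "\<And>m. N \<le> m \<Longrightarrow> inf \<bar>v m - v N\<bar> e \<le> h" by blast
  have "inf \<bar>v m - v n\<bar> e \<le> h + h" if "N \<le> m" "N \<le> n" for m n
  proof -
    have "inf \<bar>v m - v n\<bar> e \<le> inf \<bar>v m - v N\<bar> e + inf \<bar>v N - v n\<bar> e"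
      using inf_abs_add_le[of "v m - v N" "v N - v n"] by simp
    also have "\<dots> \<le> h + h"
      using h(2)[OF that(1)] h(2)[OF that(2)] by (intro add_mono) (simp_all add: abs_minus_commute)
    finally show ?thesis .
  qed
  moreover have "\<phi> (h + h) \<le> \<eta>" using h by (simp add: phi_add)
  ultimately show "\<exists>N h. \<phi> h \<le> \<eta> \<and> (\<forall>m\<ge>N. \<forall>n\<ge>N. inf \<bar>v m - v n\<bar> e \<le> h)" by blast
qed

lemma L1_cauchy_of_L1_limit:
  assumes "(\<lambda>n. \<phi> \<bar>f n - x\<bar>) \<longlonglongrightarrow> 0" "0 < \<eta>"
  shows "\<exists>N. \<forall>m\<ge>N. \<forall>n\<ge>N. \<phi> \<bar>f m - f n\<bar> \<le> \<eta>"
proof -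
  have "eventually (\<lambda>n. \<phi> \<bar>f n - x\<bar> < \<eta> / 2) sequentially"
    using assms by (intro order_tendstoD) auto
  then obtain N where N: "\<And>n. N \<le> n \<Longrightarrow> \<phi> \<bar>f n - x\<bar> < \<eta> / 2"
    by (auto simp: eventually_sequentially)
  have "\<phi> \<bar>f m - f n\<bar> \<le> \<eta>" if "N \<le> m" "N \<le> n" for m n
    using phi_abs_triangle[of "f m - x" "x - f n"] N[OF that(1)] N[OF that(2)]
    by (simp add: abs_minus_commute)
  then show ?thesis by blast
qed

lemma unit_limit_of_L1_limit:
  assumes f: "unit_cauchy f" and lim: "(\<lambda>n. \<phi> \<bar>f n - x\<bar>) \<longlonglongrightarrow> 0"
  shows "unit_limit f x"
  unfolding unit_limit_def
proof (intro allI impI)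
  fix \<eta> :: real assume \<eta>: "0 < \<eta>"
  then obtain N h where h: "\<phi> h \<le> \<eta> / 2"
      "\<And>m n. N \<le> m \<Longrightarrow> N \<le> n \<Longrightarrow> inf \<bar>f m - f n\<bar> e \<le> h"
    using f unfolding unit_cauchy_def by (meson half_gt_zero)
  have "eventually (\<lambda>n. \<phi> \<bar>f n - x\<bar> < \<eta> / 2) sequentially"
    using lim \<eta> by (intro order_tendstoD) auto
  then have "eventually (\<lambda>n. N \<le> n \<and> \<phi> \<bar>f n - x\<bar> < \<eta> / 2) sequentially"
    by (intro eventually_conj eventually_ge_at_top)
  then obtain M where M: "N \<le> M" "\<phi> \<bar>f M - x\<bar> < \<eta> / 2"
    using eventually_happens'[OF sequentially_bot] by blast
  have "inf \<bar>f m - x\<bar> e \<le> h + \<bar>f M - x\<bar>" if "N \<le> m" for m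
  proof -
    have "inf \<bar>f m - x\<bar> e \<le> inf \<bar>f m - f M\<bar> e + inf \<bar>f M - x\<bar> e"
      using inf_abs_add_le[of "f m - f M" "f M - x"] by simp
    also have "\<dots> \<le> h + \<bar>f M - x\<bar>"
      using h(2)[OF that M(1)] by (intro add_mono) simp_all
    finally show ?thesis .
  qed
  moreover have "\<phi> (h + \<bar>f M - x\<bar>) \<le> \<eta>" using h M by (simp add: phi_add)
  ultimately show "\<exists>N h. \<phi> h \<le> \<eta> \<and> (\<forall>m\<ge>N. inf \<bar>f m - x\<bar> e \<le> h)" by blast
qed

section \<open>Positive supermartingales are Cauchy\<close>

text \<open>
  The left side measures how much of \<open>p\<close> has dropped below \<open>0\<close> where \<open>q\<close> is above \<open>0\<close>.  Let \<open>d\<close> be what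
  remains of the negative part of \<open>p\<close> after removing this amount.  Then \<open>E n d\<close> is nonnegative and
  dominates \<open>- q - pprt q\<close>, hence also the positive part of that element, which is the negative part of \<open>q\<close>
  because the two parts of \<open>q\<close> are disjoint.
\<close>

lemma downcrossing_inequality:
  assumes n: "1 \<le> n" and q: "E n q = q" and p: "E n p \<le> q"
  shows "\<phi> (inf (pprt q) (pprt (- p))) \<le> \<phi> (inf q 0) - \<phi> (inf p 0)"
proof -
  define d where "d = pprt (pprt (- p) - pprt q)"
  have d_eq: "d = pprt (- p) - inf (pprt q) (pprt (- p))"
    unfolding d_def pprt_diff_eq[symmetric] by (simp only: inf.commute)
  have "- p - pprt q \<le> pprt (- p) - pprt q"
    by (intro diff_right_mono) (simp add: pprt_def)
  also have "\<dots> \<le> d" by (simp add: d_def pprt_def)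
  finally have "E n (- p - pprt q) \<le> E n d" by (rule E_mono[OF n])
  then have "- E n p - pprt q \<le> E n d"
    by (simp only: E_diff[OF n] E_minus[OF n] E_fix_pprt[OF n q])
  moreover have "- q - pprt q \<le> - E n p - pprt q"
    using p by (intro diff_right_mono) simp
  ultimately have "- q - pprt q \<le> E n d" by (rule order_trans[rotated])
  moreover have "0 \<le> E n d" using n by (intro E_nonneg) (auto simp: d_def)
  ultimately have "pprt (- q - pprt q) \<le> E n d" by (simp add: pprt_def)
  also have "pprt (- q - pprt q) = pprt (- q)"
  proof -
    have "- q - pprt q = pprt (- q) - 2 *\<^sub>R pprt q"
      using arg_cong[OF prts[of q], of uminus] by (simp add: pprt_neg scaleR_2 algebra_simps)
    then have "pprt (- q - pprt q) = pprt (- q) - inf (pprt (- q)) (2 *\<^sub>R pprt q)"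
      by (simp only: pprt_diff_eq)
    also have "inf (pprt (- q)) (2 *\<^sub>R pprt q) = 0"
      using disjoint_scaleR[OF inf_pprt_pprt_minus[of q], of 2] by (simp add: inf.commute)
    finally show ?thesis by simp
  qed
  finally have "\<phi> (pprt (- q)) \<le> \<phi> d"
    using phi_mono phi_E[OF n] by metis
  moreover have "\<phi> (pprt (- x)) = - \<phi> (inf x 0)" for x
    by (simp only: pprt_neg nprt_def linear_neg[OF phi_linear])
  ultimately show ?thesis
    by (simp only: d_eq phi_diff)
qed

lemma supermartingale_truncate:
  assumes v: "supermartingale v"
  shows "supermartingale (\<lambda>n. inf (v n) (c *\<^sub>R e))"
  unfolding supermartingale_def
proof (intro conjI allI impI)
  fix n :: nat assume n: "1 \<le> n"
  have ce: "E n (c *\<^sub>R e) = c *\<^sub>R e" by (simp only: E_scaleR[OF n] E_unit[OF n])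
  show "E n (inf (v n) (c *\<^sub>R e)) = inf (v n) (c *\<^sub>R e)"
    using v n ce by (intro E_fix_inf) (auto simp: supermartingale_def)
  fix m assume m: "n \<le> m"
  have "E n (inf (v m) (c *\<^sub>R e)) \<le> E n (v m)" "E n (inf (v m) (c *\<^sub>R e)) \<le> E n (c *\<^sub>R e)"
    by (intro E_mono[OF n] inf_le1 inf_le2)+
  moreover have "E n (v m) \<le> v n" using v n m by (simp add: supermartingale_def)
  ultimately show "E n (inf (v m) (c *\<^sub>R e)) \<le> inf (v n) (c *\<^sub>R e)"
    unfolding ce by (intro inf_greatest) (auto intro: order_trans)
qed

lemma downcrossing_supermartingale:
  assumes v: "supermartingale v" and n: "1 \<le> n" "n \<le> m"
  shows "\<phi> (inf (pprt (v n - c *\<^sub>R e)) (pprt (c *\<^sub>R e - v m)))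
    \<le> \<phi> (inf (v n) (c *\<^sub>R e)) - \<phi> (inf (v m) (c *\<^sub>R e))"
proof -
  have ce: "E n (c *\<^sub>R e) = c *\<^sub>R e" by (simp only: E_scaleR[OF n(1)] E_unit[OF n(1)])
  have eq: "inf (a - c *\<^sub>R e) 0 = inf a (c *\<^sub>R e) - c *\<^sub>R e" for a
    using add_inf_distrib_right[of a "c *\<^sub>R e" "- c *\<^sub>R e"] by simp
  have "E n (v n - c *\<^sub>R e) = v n - c *\<^sub>R e" "E n (v m - c *\<^sub>R e) \<le> v n - c *\<^sub>R e"
    using v n by (auto simp: E_diff ce supermartingale_def)
  from downcrossing_inequality[OF n(1) this] show ?thesis
    by (simp add: eq phi_diff)
qed

text \<open>
  If \<open>a - b\<close> is large, a level \<open>t i\<close> of a fine grid lies near the midpoint of \<open>b\<close> and \<open>a\<close>, and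
  there \<open>inf (a - t i) (t i - b)\<close> is almost \<open>(a - b) / 2\<close>.  So \<open>a - b\<close> is at most the mesh
  plus twice the sum of all downcrossing_inequality terms, and the \<open>\<phi>\<close>-value of this sum is an increment of the
  decreasing sequence \<open>F\<close>.
\<close>

lemma bounded_supermartingale_L1_cauchy:
  assumes v: "supermartingale v" and bd: "\<And>n. 1 \<le> n \<Longrightarrow> 0 \<le> v n \<and> v n \<le> k *\<^sub>R e"
    and \<eta>: "0 < \<eta>"
  shows "\<exists>N. \<forall>m\<ge>N. \<forall>n\<ge>N. \<phi> \<bar>v m - v n\<bar> \<le> \<eta>"
proof -
  \<comment> \<open>the mesh of the grid; its contribution \<open>\<epsilon> \<phi>(e)\<close> is at most \<open>\<eta> / 4\<close>\<close>
  define \<epsilon> where "\<epsilon> = \<eta> / (4 * (\<phi> e + 1))"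
  have e: "0 \<le> \<phi> e" by (intro phi_nonneg e_nonneg)
  then have \<epsilon>: "0 < \<epsilon>" "\<epsilon> * \<phi> e \<le> \<eta> / 4"
    using \<eta> by (simp_all add: \<epsilon>_def field_simps)
  obtain J :: nat where J: "k \<le> real J * \<epsilon>"
    using reals_Archimedean3[OF \<epsilon>(1)] by (meson less_imp_le)
  define t where "t i = (real i * \<epsilon>) *\<^sub>R e" for i
  have t: "0 \<le> t i" for i using \<epsilon> by (simp add: t_def ce_nonneg)
  define F where "F n = (\<Sum>i\<le>J. \<phi> (inf (v n) (t i)))" for n
  have F_dec: "F m \<le> F n" if "1 \<le> n" "n \<le> m" for n m
    unfolding F_def t_def using that supermartingale_truncate[OF v]
    by (intro sum_mono phi_supermartingale_le)
  have F_pos: "0 \<le> F n" if "1 \<le> n" for n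
    unfolding F_def using bd[OF that] t by (intro sum_nonneg phi_nonneg inf_greatest) auto
  have "Inf (F ` {1..}) < Inf (F ` {1..}) + \<eta> / 8" using \<eta> by simp
  then obtain N where N: "1 \<le> N" "F N < Inf (F ` {1..}) + \<eta> / 8"
    by (subst (asm) cInf_less_iff) (use F_pos in \<open>auto intro!: bdd_belowI2[where m = 0]\<close>)
  have Inf_le: "Inf (F ` {1..}) \<le> F m" if "1 \<le> m" for m
    using that F_pos by (intro cINF_lower bdd_belowI2[where m = 0]) auto
  have key: "\<phi> \<bar>v n - v m\<bar> \<le> \<eta>" if nm: "N \<le> n" "n \<le> m" for n m
  proof -
    have n: "1 \<le> n" "1 \<le> m" using N nm by auto
    define a b where "a = v n" and "b = v m"
    define c where "c i = inf (pprt (a - t i)) (pprt (t i - b))" for i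
    have c0: "0 \<le> c i" for i by (simp add: c_def)
    define S where "S = (\<Sum>i\<le>J. c i)"
    have S0: "0 \<le> S" unfolding S_def by (intro sum_nonneg c0)
    have cS: "c i \<le> S" if "i \<le> J" for i
      unfolding S_def using that c0 sum_mono2[of "{..J}" "{i}" c] by simp
    have "\<phi> S \<le> F n - F m"
      unfolding S_def phi_sum F_def sum_subtractf[symmetric] c_def a_def b_def t_def
      by (intro sum_mono downcrossing_supermartingale v n nm)
    also have "\<dots> \<le> \<eta> / 8"
      using F_dec[OF N(1) nm(1)] Inf_le[OF n(2)] N(2) by simp
    finally have phiS: "\<phi> S \<le> \<eta> / 8" .
    \<comment> \<open>\<open>inf u v + inf u v = u + v - \<bar>u - v\<bar>\<close> turns the crossing of \<open>t i\<close> into the distance of \<open>a + b\<close> from \<open>2 t i\<close>\<close>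
    have grid: "a - b - (S + S) \<le> \<bar>(a + b) - real i *\<^sub>R (2 * \<epsilon>) *\<^sub>R e\<bar>" if i: "i \<le> J" for i
    proof -
      have "inf (a - t i) (t i - b) \<le> c i"
        unfolding c_def by (intro inf_mono) (simp_all add: pprt_def)
      then have "inf (a - t i) (t i - b) \<le> S" using cS[OF i] by simp
      then have "inf (a - t i) (t i - b) + inf (a - t i) (t i - b) \<le> S + S"
        by (intro add_mono)
      then have "(a - t i) + (t i - b) - \<bar>(a - t i) - (t i - b)\<bar> \<le> S + S"
        by (simp only: double_inf_eq_diff_abs)
      moreover have "(a - t i) + (t i - b) = a - b" by simp
      moreover have "(a - t i) - (t i - b) = (a + b) - real i *\<^sub>R (2 * \<epsilon>) *\<^sub>R e"
        using scaleR_left_distrib[of "real i * \<epsilon>" "real i * \<epsilon>" e]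
        by (simp add: t_def algebra_simps)
      ultimately have "a - b - \<bar>(a + b) - real i *\<^sub>R (2 * \<epsilon>) *\<^sub>R e\<bar> \<le> S + S" by simp
      then show ?thesis by (simp only: diff_le_eq add.commute)
    qed
    have "a - b - (S + S) \<le> sup ((1/2) *\<^sub>R (2 * \<epsilon>) *\<^sub>R e) (sup (a + b - real J *\<^sub>R (2 * \<epsilon>) *\<^sub>R e) (- (a + b)))"
      by (rule le_of_le_distance_to_grid) (rule grid)
    also have "\<dots> \<le> \<epsilon> *\<^sub>R e"
    proof (intro sup_least)
      show "(1/2) *\<^sub>R (2 * \<epsilon>) *\<^sub>R e \<le> \<epsilon> *\<^sub>R e" by simp
      have ab: "0 \<le> a" "0 \<le> b" "a \<le> k *\<^sub>R e" "b \<le> k *\<^sub>R e"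
        using bd n by (auto simp: a_def b_def)
      have "a + b \<le> k *\<^sub>R e + k *\<^sub>R e" using ab by (intro add_mono)
      also have "\<dots> = (2 * k) *\<^sub>R e" by (simp flip: scaleR_2)
      also have "\<dots> \<le> (real J * (2 * \<epsilon>)) *\<^sub>R e"
        using J by (intro scaleR_right_mono e_nonneg) simp
      finally have "a + b - real J *\<^sub>R (2 * \<epsilon>) *\<^sub>R e \<le> 0" by simp
      then show "a + b - real J *\<^sub>R (2 * \<epsilon>) *\<^sub>R e \<le> \<epsilon> *\<^sub>R e"
        using ce_nonneg[of \<epsilon>] \<epsilon> by (meson less_imp_le order_trans)
      have "- (a + b) \<le> 0" using add_nonneg_nonneg[OF ab(1,2)] by (simp only: neg_le_0_iff_le)
      then show "- (a + b) \<le> \<epsilon> *\<^sub>R e"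
        using ce_nonneg[of \<epsilon>] \<epsilon> by (meson less_imp_le order_trans)
    qed
    finally have "a - b \<le> \<epsilon> *\<^sub>R e + (S + S)" by (simp only: diff_le_eq)
    moreover have "0 \<le> \<epsilon> *\<^sub>R e + (S + S)" using S0 \<epsilon> by (intro add_nonneg_nonneg ce_nonneg) auto
    ultimately have "pprt (a - b) \<le> \<epsilon> *\<^sub>R e + (S + S)" by (simp only: pprt_def le_sup_iff)
    then have "\<phi> (pprt (a - b)) \<le> \<eta> / 4 + \<eta> / 4"
      using phi_mono[of "pprt (a - b)" "\<epsilon> *\<^sub>R e + (S + S)"] \<epsilon>(2) phiS
      by (simp add: phi_add phi_scaleR)
    moreover have "0 \<le> \<phi> (a - b)"
      using phi_supermartingale_le[OF v n(1) nm(2)] by (simp add: phi_diff a_def b_def)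
    ultimately show ?thesis
      by (simp add: abs_eq_pprt phi_diff phi_scaleR flip: a_def b_def)
  qed
  have "\<phi> \<bar>v m - v n\<bar> \<le> \<eta>" if "N \<le> m" "N \<le> n" for m n
    using key[of m n] key[of n m] that by (cases "m \<le> n") (simp_all add: abs_minus_commute)
  then show ?thesis by blast
qed

text \<open>
  The truncation at \<open>k e\<close> is a bounded supermartingale.  The excess over \<open>k e\<close> is controlled simultaneously
  for all indices by the maximal inequality at level \<open>k\<close>.
\<close>

lemma positive_supermartingale_unit_cauchy:
  assumes S: "supermartingale S" and pos: "\<And>n. 1 \<le> n \<Longrightarrow> 0 \<le> S n"
  shows "unit_cauchy S"
  unfolding unit_cauchy_def
proof (intro allI impI)
  fix \<eta> :: real assume \<eta>: "0 < \<eta>"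
  define k where "k = 4 * \<phi> (S 1) / \<eta> + 1"
  have S1: "0 \<le> \<phi> (S 1)" by (intro phi_nonneg pos) simp
  then have k: "0 < k" "\<phi> (S 1) / k \<le> \<eta> / 4"
    using \<eta> by (simp_all add: k_def field_simps add_pos_nonneg)
  define P where "P n = pprt (S n - k *\<^sub>R e)" for n
  define v where "v n = inf (S n) (k *\<^sub>R e)" for n
  have S_eq: "S n = v n + P n" for n 
    unfolding v_def P_def pprt_diff_eq[symmetric] by (metis add.commute diff_add_cancel)
  have "\<exists>h. \<phi> h \<le> \<eta> / 4 \<and> (\<forall>m\<ge>1. inf (P m) e \<le> h)"
  proof (rule dominating_element)
    fix K :: nat assume K: "1 \<le> K"
    have "Sup_fin (P ` {1..K}) \<le> pprt (Sup_fin (S ` {1..K}) - k *\<^sub>R e)"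
    proof (rule Sup_fin.boundedI)
      fix x assume "x \<in> P ` {1..K}"
      then obtain m where m: "m \<in> {1..K}" "x = P m" by blast
      have "S m \<le> Sup_fin (S ` {1..K})" using m by (intro Sup_fin.coboundedI) auto
      then show "x \<le> pprt (Sup_fin (S ` {1..K}) - k *\<^sub>R e)"
        unfolding m P_def by (intro pprt_mono diff_right_mono)
    qed (use K in auto)
    then have "\<phi> (inf (Sup_fin (P ` {1..K})) e) \<le> \<phi> (inf (pprt (Sup_fin (S ` {1..K}) - k *\<^sub>R e)) e)"
      by (intro phi_mono inf_mono order_refl)
    also have "\<dots> \<le> \<phi> (S 1) / k"
      using pos K k S by (intro maximal_phi(1) supermartingale_onI) auto
    also have "\<dots> \<le> \<eta> / 4" by (rule k(2))
    finally show "\<phi> (inf (Sup_fin (P ` {1..K})) e) \<le> \<eta> / 4" .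
  qed
  then obtain h1 where h1: "\<phi> h1 \<le> \<eta> / 4" "\<And>m. 1 \<le> m \<Longrightarrow> inf (P m) e \<le> h1" by blast
  have sv: "supermartingale v"
    unfolding v_def by (rule supermartingale_truncate[OF S])
  have vb: "0 \<le> v n \<and> v n \<le> k *\<^sub>R e" if "1 \<le> n" for n
    using pos[OF that] k by (auto simp: v_def intro!: ce_nonneg)
  have "unit_cauchy v"
    by (rule unit_cauchy_of_L1_cauchy[OF sv bounded_supermartingale_L1_cauchy[OF sv vb]])
  then obtain N h where h: "\<phi> h \<le> \<eta> / 2"
      "\<And>m n. N \<le> m \<Longrightarrow> N \<le> n \<Longrightarrow> inf \<bar>v m - v n\<bar> e \<le> h"
    using \<eta> unfolding unit_cauchy_def by (meson half_gt_zero)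
  have "inf \<bar>S m - S n\<bar> e \<le> h + (h1 + h1)" if mn: "max N 1 \<le> m" "max N 1 \<le> n" for m n
  proof -
    have "S m - S n = (v m - v n) + (P m + - P n)"
      by (simp add: S_eq algebra_simps)
    then have "inf \<bar>S m - S n\<bar> e \<le> inf \<bar>v m - v n\<bar> e + inf \<bar>P m + - P n\<bar> e"
      by (simp only: inf_abs_add_le)
    also have "\<dots> \<le> inf \<bar>v m - v n\<bar> e + (inf \<bar>P m\<bar> e + inf \<bar>- P n\<bar> e)"
      by (intro add_left_mono inf_abs_add_le)
    also have "\<dots> \<le> h + (h1 + h1)"
      using mn h(2)[of m n] h1(2)[of m] h1(2)[of n] by (intro add_mono) (simp_all add: P_def)
    finally show ?thesis .
  qed
  moreover have "\<phi> (h + (h1 + h1)) \<le> \<eta>" using h h1 by (simp add: phi_add)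
  ultimately show "\<exists>N h. \<phi> h \<le> \<eta> \<and> (\<forall>m\<ge>N. \<forall>n\<ge>N. inf \<bar>S m - S n\<bar> e \<le> h)" by blast
qed

section \<open>Limits and uo-convergence\<close>

lemma unit_cauchy_diff:
  assumes f: "unit_cauchy f" and g: "unit_cauchy g"
  shows "unit_cauchy (\<lambda>n. f n - g n)"
  unfolding unit_cauchy_def
proof (intro allI impI)
  fix \<eta> :: real assume \<eta>: "0 < \<eta>"
  obtain N h where h: "\<phi> h \<le> \<eta> / 2"
      "\<And>m n. N \<le> m \<Longrightarrow> N \<le> n \<Longrightarrow> inf \<bar>f m - f n\<bar> e \<le> h"
    using f \<eta> unfolding unit_cauchy_def by (meson half_gt_zero)
  obtain N' h' where h': "\<phi> h' \<le> \<eta> / 2"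
      "\<And>m n. N' \<le> m \<Longrightarrow> N' \<le> n \<Longrightarrow> inf \<bar>g m - g n\<bar> e \<le> h'"
    using g \<eta> unfolding unit_cauchy_def by (meson half_gt_zero)
  have "inf \<bar>(f m - g m) - (f n - g n)\<bar> e \<le> h + h'" if "max N N' \<le> m" "max N N' \<le> n" for m n
  proof -
    have "(f m - g m) - (f n - g n) = (f m - f n) + (g n - g m)" by simp
    then have "inf \<bar>(f m - g m) - (f n - g n)\<bar> e \<le> inf \<bar>f m - f n\<bar> e + inf \<bar>g n - g m\<bar> e"
      by (simp only: inf_abs_add_le)
    also have "\<dots> \<le> h + h'" using h(2) h'(2) that by (intro add_mono) auto
    finally show ?thesis .
  qed
  moreover have "\<phi> (h + h') \<le> \<eta>" using h h' by (simp add: phi_add)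
  ultimately show "\<exists>N h. \<phi> h \<le> \<eta> \<and>
      (\<forall>m\<ge>N. \<forall>n\<ge>N. inf \<bar>(f m - g m) - (f n - g n)\<bar> e \<le> h)" by blast
qed

lemma unit_cauchy_minus: "unit_cauchy f \<Longrightarrow> unit_cauchy (\<lambda>n. - f n)"
  unfolding unit_cauchy_def minus_diff_minus abs_minus_cancel .

lemma unit_cauchy_pprt:
  assumes "unit_cauchy f"
  shows "unit_cauchy (\<lambda>n. pprt (f n))"
proof -
  have "inf \<bar>pprt a - pprt b\<bar> e \<le> inf \<bar>a - b\<bar> e" for a b
    by (intro inf_mono abs_pprt_diff_le order_refl)
  then show ?thesis
    using assms unfolding unit_cauchy_def by (meson order_trans)
qed

lemma unit_limit_diff:
  assumes f: "unit_limit f x" and g: "unit_limit g y"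
  shows "unit_limit (\<lambda>n. f n - g n) (x - y)"
  unfolding unit_limit_def
proof (intro allI impI)
  fix \<eta> :: real assume \<eta>: "0 < \<eta>"
  obtain N h where h: "\<phi> h \<le> \<eta> / 2" "\<And>m. N \<le> m \<Longrightarrow> inf \<bar>f m - x\<bar> e \<le> h"
    using f \<eta> unfolding unit_limit_def by (meson half_gt_zero)
  obtain N' h' where h': "\<phi> h' \<le> \<eta> / 2" "\<And>m. N' \<le> m \<Longrightarrow> inf \<bar>g m - y\<bar> e \<le> h'"
    using g \<eta> unfolding unit_limit_def by (meson half_gt_zero)
  have "inf \<bar>(f m - g m) - (x - y)\<bar> e \<le> h + h'" if m: "max N N' \<le> m" for m
  proof -
    have "(f m - g m) - (x - y) = (f m - x) + - (g m - y)" by simp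
    then have "inf \<bar>(f m - g m) - (x - y)\<bar> e \<le> inf \<bar>f m - x\<bar> e + inf \<bar>- (g m - y)\<bar> e"
      by (simp only: inf_abs_add_le)
    also have "\<dots> \<le> h + h'" 
      unfolding abs_minus_cancel using h(2) h'(2) m by (intro add_mono) auto
    finally show ?thesis .
  qed
  moreover have "\<phi> (h + h') \<le> \<eta>" using h h' by (simp add: phi_add)
  ultimately show "\<exists>N h. \<phi> h \<le> \<eta> \<and> (\<forall>m\<ge>N. inf \<bar>(f m - g m) - (x - y)\<bar> e \<le> h)" by blast
qed

lemma truncation_error_tendsto_0:
  assumes y: "0 \<le> y"
  shows "(\<lambda>k. \<phi> (y - inf y (real k *\<^sub>R e))) \<longlonglongrightarrow> 0"
proof -
  define s where "s k = inf y (real k *\<^sub>R e)" for k :: nat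
  have inc: "incseq s" and lub: "isLub UNIV (range s) y"
    using unit y unfolding weak_unit_def s_def by auto
  obtain l where l: "s \<longlonglongrightarrow> l"
    using incseq_bounded_convergent[OF oc inc, of y] by (auto simp: s_def convergent_def)
  have "l \<le> y"
    by (rule tendsto_le_banach_lattice[OF l tendsto_const]) (auto simp: s_def)
  moreover have "y \<le> l"
    using lub incseq_tendsto_upper[OF inc l]
    by (auto simp: isLub_def leastP_def setle_def setge_def isUb_def)
  ultimately have "(\<lambda>k. \<phi> (y - s k)) \<longlonglongrightarrow> \<phi> (y - y)"
    using l by (intro tendsto_phi tendsto_diff tendsto_const) simp
  then show ?thesis by (simp add: s_def linear_0[OF phi_linear])
qed

text \<open>
  For \<open>y \<ge> 0\<close> write \<open>y = inf y (k e) + R\<close>.  Then \<open>inf \<bar>f m - x\<bar> y\<close> is at most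
  \<open>k h + R\<close>, where \<open>\<phi> R\<close> is small for large \<open>k\<close> because \<open>e\<close> is a weak unit, and \<open>k \<phi>(h)\<close> is
  small for fixed \<open>k\<close>.  So a lower bound of all eventual bounds has a positive part on which \<open>\<phi>\<close> vanishes.
\<close>

lemma uo_converges_of_unit_limit:
  assumes f: "unit_limit f x"
  shows "uo_converges f x sequentially"
  unfolding uo_converges_def
proof (intro allI impI)
  fix y :: 'a assume y: "0 \<le> y"
  define u where "u i = inf \<bar>f i - x\<bar> y" for i
  have u: "0 \<le> u i" for i using y by (simp add: u_def)
  define D where "D = {d. eventually (\<lambda>i. u i \<le> d) sequentially}"
  have D_pos: "0 \<le> d" if "d \<in> D" for d
    using that u eventually_happens'[OF sequentially_bot] unfolding D_def
    by (metis (mono_tags, lifting) mem_Collect_eq order_trans)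
  have lower: "w \<le> 0" if w: "\<And>d. d \<in> D \<Longrightarrow> w \<le> d" for w
  proof -
    have "\<phi> (pprt w) \<le> \<epsilon>" if \<epsilon>: "0 < \<epsilon>" for \<epsilon>
    proof -
      have "eventually (\<lambda>k. \<phi> (y - inf y (real k *\<^sub>R e)) < \<epsilon> / 2 \<and> 1 \<le> k) sequentially"
        using truncation_error_tendsto_0[OF y] \<epsilon>
        by (intro eventually_conj order_tendstoD(2) eventually_ge_at_top) auto
      then obtain k :: nat where k: "\<phi> (y - inf y (real k *\<^sub>R e)) < \<epsilon> / 2" "1 \<le> k"
        using eventually_happens'[OF sequentially_bot] by blast
      define R where "R = y - inf y (real k *\<^sub>R e)"
      have R: "0 \<le> R" by (simp add: R_def)
      have "0 < \<epsilon> / (2 * real k)" using \<epsilon> k by simp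
      then obtain N h where h: "\<phi> h \<le> \<epsilon> / (2 * real k)" "\<And>m. N \<le> m \<Longrightarrow> inf \<bar>f m - x\<bar> e \<le> h"
        using f unfolding unit_limit_def by blast
      have "u m \<le> real k *\<^sub>R h + R" if m: "N \<le> m" for m
      proof -
        define a where "a = \<bar>f m - x\<bar>"
        have a: "0 \<le> a" by (simp add: a_def)
        have ky: "0 \<le> inf y (real k *\<^sub>R e)" using y by (simp add: ce_nonneg)
        have "u m = inf (inf y (real k *\<^sub>R e) + R) a"
          by (simp add: u_def a_def R_def inf.commute)
        also have "\<dots> \<le> inf (inf y (real k *\<^sub>R e)) a + inf R a"
          by (intro inf_add_le ky R a)
        also have "\<dots> \<le> real k *\<^sub>R inf a e + R"
        proof (intro add_mono inf_le1)
          have "a \<le> real k *\<^sub>R a"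
            using scaleR_right_mono[of 1 "real k" a] k a by simp
          then have "inf (inf y (real k *\<^sub>R e)) a \<le> inf (real k *\<^sub>R a) (real k *\<^sub>R e)"
            by (intro inf_greatest) (auto intro: le_infI1 le_infI2)
          then show "inf (inf y (real k *\<^sub>R e)) a \<le> real k *\<^sub>R inf a e"
            by (simp add: scaleR_inf)
        qed
        also have "\<dots> \<le> real k *\<^sub>R h + R"
          using h(2)[OF m] by (intro add_right_mono scaleR_left_mono) (auto simp: a_def)
        finally show ?thesis .
      qed
      then have D: "real k *\<^sub>R h + R \<in> D"
        unfolding D_def eventually_sequentially by blast
      then have "pprt w \<le> real k *\<^sub>R h + R"
        using w[OF D] D_pos[OF D] by (simp add: pprt_def)
      then have "\<phi> (pprt w) \<le> real k * \<phi> h + \<phi> R"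
        using phi_mono by (fastforce simp: phi_add phi_scaleR)
      also have "real k * \<phi> h \<le> real k * (\<epsilon> / (2 * real k))"
        using h(1) by (intro mult_left_mono) auto
      finally show ?thesis using k by (simp add: R_def)
    qed
    then have "\<phi> (pprt w) \<le> 0" by (rule field_le_epsilon[of _ 0, simplified])
    then have "pprt w = 0" by (intro phi_eq_0) auto
    then show "w \<le> 0" by (simp add: le_zero_iff_zero_pprt)
  qed
  have "directed_down_to D 0"
    unfolding directed_down_to_def
  proof (intro conjI ballI)
    have "y \<in> D" by (simp add: D_def u_def)
    then show "D \<noteq> {}" by blast
  next
    fix a b assume "a \<in> D" "b \<in> D"
    then have "inf a b \<in> D" by (auto simp: D_def eventually_conj)
    then show "\<exists>c\<in>D. c \<le> a \<and> c \<le> b" by (intro bexI[of _ "inf a b"]) auto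
  next
    show "isGlb UNIV D 0"
      using D_pos lower by (auto simp: isGlb_def greatestP_def isLb_def setge_def setle_def)
  qed
  moreover have "\<forall>d\<in>D. eventually (\<lambda>i. \<bar>inf \<bar>f i - x\<bar> y - 0\<bar> \<le> d) sequentially"
    using u unfolding D_def u_def by simp
  ultimately show "order_converges (\<lambda>i. inf \<bar>f i - x\<bar> y) 0 sequentially"
    unfolding order_converges_def by blast
qed

text \<open>
  The limit is the limit inferior \<open>y\<close>: the infima \<open>g N\<close> of the tails exist by order continuity, and they
  increase and are norm bounded, so the KB property applies to them.  The Cauchy bound for
  \<open>f m - f l\<close> passes to \<open>f m - g N\<close> by distributivity and then to both \<open>f m - y\<close> and \<open>y - f m\<close>.
\<close>

lemma KB_unit_limit_exists:
  assumes KB: "KB_space TYPE('a)" and f: "unit_cauchy f"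
    and pos: "\<And>n. 1 \<le> n \<Longrightarrow> 0 \<le> f n" and bd: "\<And>n. 1 \<le> n \<Longrightarrow> norm (f n) \<le> C"
  shows "\<exists>y. unit_limit f y"
proof -
  define i where "i N j = Inf_fin (f ` {N..N + j})" for N j :: nat
  have i_Suc: "i N (Suc j) = inf (f (N + Suc j)) (i N j)" for N j
  proof -
    have "{N..N + Suc j} = insert (N + Suc j) {N..N + j}" by auto
    then show ?thesis unfolding i_def image_insert by (simp add: Inf_fin.insert)
  qed
  have i_0: "i N 0 = f N" for N by (simp add: i_def)
  have i_pos: "0 \<le> i N j" if "1 \<le> N" for N j
    using that pos unfolding i_def by (intro Inf_fin.boundedI) auto
  have "\<exists>l. i N \<longlonglongrightarrow> l" if "1 \<le> N" for N
  proof -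
    have "convergent (\<lambda>j. - i N j)"
      using i_pos[OF that]
      by (intro incseq_bounded_convergent[OF oc, of _ 0] incseq_SucI) (auto simp: i_Suc)
    then show ?thesis
      unfolding convergent_def using tendsto_minus by fastforce
  qed
  then obtain g where g: "\<And>N. 1 \<le> N \<Longrightarrow> i N \<longlonglongrightarrow> g N" by metis
  have g_le: "g N \<le> f N" if "1 \<le> N" for N
  proof (rule tendsto_le_banach_lattice[OF g[OF that] tendsto_const])
    have "i N j \<le> f N" for j by (induction j) (auto simp: i_0 i_Suc intro: le_infI2)
    then show "\<forall>\<^sub>F j in sequentially. i N j \<le> f N" by simp
  qed simp
  have g_pos: "0 \<le> g N" if "1 \<le> N" for N
    using tendsto_nonneg[OF g[OF that]] i_pos[OF that] by simp
  have g_Suc: "g N \<le> g (Suc N)" if N: "1 \<le> N" for N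
  proof (rule tendsto_le_banach_lattice[OF LIMSEQ_Suc[OF g[OF N]] g])
    have "i N (Suc j) \<le> i (Suc N) j" for j
      unfolding i_def by (rule Inf_fin.subset_imp) auto
    then show "\<forall>\<^sub>F j in sequentially. i N (Suc j) \<le> i (Suc N) j" by simp
  qed (use N in auto)
  have "incseq (\<lambda>N. g (Suc N))" by (intro incseq_SucI g_Suc) simp
  moreover have "norm (g (Suc N)) \<le> C" for N
    using norm_mono_nonneg[OF g_pos g_le, of "Suc N"] bd[of "Suc N"] by simp
  then have "bounded (range (\<lambda>N. g (Suc N)))" by (auto simp: bounded_iff)
  ultimately obtain y where y: "(\<lambda>N. g (Suc N)) \<longlonglongrightarrow> y"
    using KB unfolding KB_space_def convergent_def by blast
  have g_y: "g N \<le> y" if "1 \<le> N" for N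
    using incseq_tendsto_upper[OF \<open>incseq (\<lambda>N. g (Suc N))\<close> y, of "N - 1"] that by simp
  have "unit_limit f y"
    unfolding unit_limit_def
  proof (intro allI impI)
    fix \<eta> :: real assume "0 < \<eta>"
    then obtain N0 h where h: "\<phi> h \<le> \<eta>"
        "\<And>m n. N0 \<le> m \<Longrightarrow> N0 \<le> n \<Longrightarrow> inf \<bar>f m - f n\<bar> e \<le> h"
      using f unfolding unit_cauchy_def by blast
    define N where "N = max N0 1"
    have N: "1 \<le> N" by (simp add: N_def)
    have le_h: "inf (f m - f l) e \<le> h" if "N \<le> m" "N \<le> l" for m l
    proof -
      have "inf (f m - f l) e \<le> inf \<bar>f m - f l\<bar> e"
        by (intro inf_mono abs_ge_self order_refl)
      also have "\<dots> \<le> h" using that by (intro h(2)) (auto simp: N_def)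
      finally show ?thesis .
    qed
    \<comment> \<open>the two one-sided bounds need no factor two, since \<open>\<bar>x\<bar>\<close> is the supremum of \<open>x\<close> and \<open>- x\<close>\<close>
    have "inf \<bar>f m - y\<bar> e \<le> h" if m: "N \<le> m" for m
    proof -
      have "inf (f m - i N j) e \<le> h" for j
      proof (induction j)
        case 0
        then show ?case using le_h[OF m] by (simp add: i_0)
      next
        case (Suc j)
        have "f m - i N (Suc j) = sup (f m - f (N + Suc j)) (f m - i N j)"
          unfolding i_Suc diff_inf_eq_sup add_sup_distrib_left by simp
        then have "inf (f m - i N (Suc j)) e
            \<le> sup (inf (f m - f (N + Suc j)) e) (inf (f m - i N j) e)"
          by (simp only: inf_sup_distrib_le)
        also have "\<dots> \<le> h" using Suc le_h[OF m, of "N + Suc j"] by (intro sup_least) auto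
        finally show ?case .
      qed
      then have "inf (f m - g N) e \<le> h"
        by (intro tendsto_le_banach_lattice[OF tendsto_inf_const[OF tendsto_diff[OF tendsto_const g[OF N]]]
            tendsto_const]) auto
      moreover have "inf (f m - y) e \<le> inf (f m - g N) e"
        by (intro inf_mono diff_left_mono g_y[OF N] order_refl)
      ultimately have 1: "inf (f m - y) e \<le> h" by (rule order_trans[rotated])
      have "inf (g (Suc N') - f m) e \<le> h" if "N \<le> N'" for N'
      proof -
        have "inf (g (Suc N') - f m) e \<le> inf (f (Suc N') - f m) e"
          by (intro inf_mono diff_right_mono g_le order_refl) simp
        also have "\<dots> \<le> h" using that m by (intro le_h) auto
        finally show ?thesis .
      qed
      then have 2: "inf (y - f m) e \<le> h"
        by (intro tendsto_le_banach_lattice[OF tendsto_inf_const[OF tendsto_diff[OF y tendsto_const]]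
            tendsto_const]) (auto simp: eventually_sequentially)
      have "inf \<bar>f m - y\<bar> e \<le> sup (inf (f m - y) e) (inf (y - f m) e)"
        using inf_sup_distrib_le[of "f m - y" "y - f m" e] by (simp add: abs_lattice)
      also have "\<dots> \<le> h" using 1 2 by (rule sup_least)
      finally show ?thesis .
    qed
    then show "\<exists>N h. \<phi> h \<le> \<eta> \<and> (\<forall>m\<ge>N. inf \<bar>f m - y\<bar> e \<le> h)" using h(1) by blast
  qed
  then show ?thesis ..
qed

section \<open>Submartingales\<close>

lemma submartingale_fix: "submartingale E z \<Longrightarrow> 1 \<le> n \<Longrightarrow> E n (z n) = z n"
  unfolding submartingale_def using E_E[of n n] by auto

lemma submartingale_le: "submartingale E z \<Longrightarrow> 1 \<le> n \<Longrightarrow> n \<le> m \<Longrightarrow> z n \<le> E n (z m)"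
  unfolding submartingale_def by blast

lemma supermartingale_minus: "submartingale E z \<Longrightarrow> supermartingale (\<lambda>n. - z n)"
  unfolding supermartingale_def by (simp add: E_minus submartingale_fix submartingale_le)

text \<open>
  The martingale \<open>A\<close> of the Krickeberg decomposition is built from the positive parts of \<open>z\<close>.  Each
  \<open>E n\<close> is bounded, so for fixed \<open>n\<close> the increasing sequence \<open>E n (pprt (z m))\<close> is norm bounded.  This
  bound involves the norm of \<open>E n\<close> and may grow with \<open>n\<close>, so the limit is constructed from \<open>z\<close> itself rather
  than from limits of \<open>A\<close> and \<open>A - z\<close>.
\<close>

theorem norm_bounded_submartingale_uo_converges:
  assumes KB: "KB_space TYPE('a)" and z: "submartingale E z"
    and bd: "\<And>n. 1 \<le> n \<Longrightarrow> norm (z n) \<le> C"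
  shows "\<exists>x. uo_converges z x sequentially"
proof -
  have norm_pprt: "norm (pprt x) \<le> norm x" for x :: 'a
    using abs_pprt_diff_le[of x 0] by (intro norm_mono_abs) simp
  define s where "s n j = E n (pprt (z (n + j)))" for n j
  have s_Suc: "s n j \<le> s n (Suc j)" if n: "1 \<le> n" for n j
  proof -
    have m: "1 \<le> n + j" "n \<le> n + j" using n by auto
    have "z (n + j) \<le> E (n + j) (z (n + Suc j))"
      using m by (intro submartingale_le[OF z]) auto
    also have "\<dots> \<le> E (n + j) (pprt (z (n + Suc j)))"
      by (rule E_mono[OF m(1)]) (simp add: pprt_def)
    finally have "pprt (z (n + j)) \<le> E (n + j) (pprt (z (n + Suc j)))"
      using E_nonneg[OF m(1) zero_le_pprt] by (simp add: pprt_def)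
    then have "E n (pprt (z (n + j))) \<le> E n (E (n + j) (pprt (z (n + Suc j))))"
      by (rule E_mono[OF n])
    then show ?thesis by (simp only: s_def E_E_le[OF n m(2)])
  qed
  then have s_inc: "incseq (s n)" if "1 \<le> n" for n
    using that by (intro incseq_SucI)
  have "\<exists>l. s n \<longlonglongrightarrow> l" if n: "1 \<le> n" for n
  proof -
    obtain B where B: "0 \<le> B" "\<And>x. norm (E n x) \<le> norm x * B"
      using bounded_linear.nonneg_bounded[OF E_bounded[OF n]] by blast
    have "norm (s n j) \<le> C * B" for j
    proof -
      have "norm (s n j) \<le> norm (pprt (z (n + j))) * B" unfolding s_def by (rule B(2))
      also have "\<dots> \<le> C * B"
        using norm_pprt[of "z (n + j)"] bd[of "n + j"] n B(1) by (intro mult_right_mono) auto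
      finally show ?thesis .
    qed
    then have "bounded (range (s n))" by (auto simp: bounded_iff)
    then show ?thesis using KB s_inc[OF n] unfolding KB_space_def convergent_def by blast
  qed
  then obtain A where A: "\<And>n. 1 \<le> n \<Longrightarrow> s n \<longlonglongrightarrow> A n" by metis
  have EA: "E n (A m) = A n" if n: "1 \<le> n" "n \<le> m" for n m
  proof -
    have "(\<lambda>j. E n (s m j)) \<longlonglongrightarrow> E n (A m)"
      using n by (intro bounded_linear.tendsto[OF E_bounded[OF n(1)]] A) simp
    moreover have "E n (s m j) = s n (j + (m - n))" for j
      using n by (simp add: s_def E_E_le[OF n] add.commute)
    moreover have "(\<lambda>j. s n (j + (m - n))) \<longlonglongrightarrow> A n"
      by (rule LIMSEQ_ignore_initial_segment[OF A[OF n(1)]])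
    ultimately show ?thesis by (simp only: LIMSEQ_unique)
  qed
  have z_A: "z n \<le> A n" "0 \<le> A n" if n: "1 \<le> n" for n
  proof -
    have "s n 0 \<le> A n" by (rule incseq_tendsto_upper[OF s_inc[OF n] A[OF n]])
    then have "pprt (z n) \<le> A n"
      by (simp add: s_def E_fix_pprt[OF n] submartingale_fix[OF z n])
    then show "z n \<le> A n" "0 \<le> A n" by (simp_all add: pprt_def)
  qed
  have sA: "supermartingale A"
    unfolding supermartingale_def using EA by simp
  have sS: "supermartingale (\<lambda>n. A n - z n)"
    unfolding supermartingale_def
    by (simp add: E_diff EA submartingale_fix[OF z] submartingale_le[OF z])
  have "unit_cauchy (\<lambda>n. A n - (A n - z n))"
    using sA sS z_A by (intro unit_cauchy_diff positive_supermartingale_unit_cauchy) auto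
  then have uz: "unit_cauchy z" by simp
  have bd_parts: "norm (pprt (z n)) \<le> C" "norm (pprt (- z n)) \<le> C" if "1 \<le> n" for n
    using norm_pprt[of "z n"] norm_pprt[of "- z n"] bd[OF that] by simp_all
  have "\<exists>y. unit_limit (\<lambda>n. pprt (z n)) y"
    by (rule KB_unit_limit_exists[OF KB unit_cauchy_pprt[OF uz] zero_le_pprt bd_parts(1)])
  moreover have "\<exists>y. unit_limit (\<lambda>n. pprt (- z n)) y"
    by (rule KB_unit_limit_exists[OF KB unit_cauchy_pprt[OF unit_cauchy_minus[OF uz]]
        zero_le_pprt bd_parts(2)])
  ultimately obtain y y' where "unit_limit (\<lambda>n. pprt (z n)) y" "unit_limit (\<lambda>n. pprt (- z n)) y'"
    by blast
  then have "unit_limit (\<lambda>n. pprt (z n) - pprt (- z n)) (y - y')"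
    by (rule unit_limit_diff)
  moreover have "pprt x - pprt (- x) = x" for x :: 'a
    by (simp add: pprt_neg prts[of x, symmetric])
  ultimately show ?thesis
    using uo_converges_of_unit_limit by auto
qed

text \<open>
  Weak convergence enters three times: through the cones \<open>{u. 0 \<le> E n u}\<close> and \<open>\<Union>\<^sub>n range (E n)\<close>, whose closures
  contain the weak limit, and through the functional \<open>\<phi>\<close> itself.
\<close>

theorem weakly_convergent_submartingale_uo_converges:
  assumes z: "submartingale E z" and r: "strict_mono r" "1 \<le> r 0"
    and weak: "weakly_converges (\<lambda>k. z (r k)) x sequentially"
  shows "uo_converges z x sequentially"
proof -
  have r1: "1 \<le> r k" and rk: "k \<le> r k" for k
    using r strict_mono_less_eq[OF r(1), of 0 k] seq_suble[OF r(1), of k] by auto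
  have z_le: "z n \<le> E n x" if n: "1 \<le> n" for n
  proof -
    define C where "C = {u. 0 \<le> E n u}"
    have "convex_cone C"
      unfolding convex_cone_iff conic_def C_def
      using E_nonneg[OF n order_refl] n
      by (auto simp: E_add E_scaleR linear_0[OF E_linear[OF n]] intro: add_nonneg_nonneg scaleR_nonneg_nonneg)
    moreover have "weakly_converges (\<lambda>k. z (r k) - z n) (x - z n) sequentially"
      using weak unfolding weakly_converges_def
      by (auto simp: linear_diff[OF bounded_linear.linear] intro!: tendsto_diff)
    moreover have "eventually (\<lambda>k. z (r k) - z n \<in> C) sequentially"
      using eventually_ge_at_top[of n]
    proof eventually_elim
      case (elim k)
      then have "n \<le> r k" using rk[of k] by simp
      then show ?case
        by (simp add: C_def E_diff[OF n] submartingale_fix[OF z n] submartingale_le[OF z n])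
    qed
    ultimately have "x - z n \<in> closure C"
      by (intro weak_limit_in_closure_cone) auto
    then obtain c where c: "\<And>j. c j \<in> C" "c \<longlonglongrightarrow> x - z n"
      unfolding closure_sequential by blast
    have "(\<lambda>j. E n (c j)) \<longlonglongrightarrow> E n (x - z n)"
      by (rule bounded_linear.tendsto[OF E_bounded[OF n] c(2)])
    then have "0 \<le> E n (x - z n)"
      by (rule tendsto_nonneg) (use c(1) in \<open>auto simp: C_def\<close>)
    then show ?thesis by (simp add: E_diff[OF n] submartingale_fix[OF z n])
  qed
  have E_x: "(\<lambda>n. \<phi> \<bar>E n x - x\<bar>) \<longlonglongrightarrow> 0"
  proof -
    define C where "C = {u. \<exists>n\<ge>1. E n u = u}"
    have stable: "E m u = u" if "1 \<le> n" "n \<le> m" "E n u = u" for n m u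
      using E_E[of m n u] that by (simp add: min_def split: if_splits)
    have "convex_cone C"
      unfolding convex_cone_iff conic_def
    proof (intro conjI ballI allI impI)
      show "0 \<in> C" unfolding C_def using linear_0[OF E_linear] by blast
      show "u + v \<in> C" if uv: "u \<in> C" "v \<in> C" for u v
      proof -
        obtain n m where n: "1 \<le> n" "E n u = u" and m: "1 \<le> m" "E m v = v"
          using uv by (auto simp: C_def)
        have "1 \<le> max n m" using n by simp
        moreover have "E (max n m) (u + v) = u + v"
          using stable[OF n(1) _ n(2), of "max n m"] stable[OF m(1) _ m(2), of "max n m"]
          by (simp add: E_add[OF \<open>1 \<le> max n m\<close>])
        ultimately show ?thesis unfolding C_def by blast
      qed
      show "c *\<^sub>R u \<in> C" if u: "u \<in> C" for u c
      proof -
        obtain n where n: "1 \<le> n" "E n u = u" using u by (auto simp: C_def)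
        have "E n (c *\<^sub>R u) = c *\<^sub>R u" by (simp only: E_scaleR[OF n(1)] n(2))
        then show ?thesis unfolding C_def using n(1) by blast
      qed
    qed
    moreover have "z (r k) \<in> C" for k
      unfolding C_def using submartingale_fix[OF z r1[of k]] r1[of k] by blast
    ultimately have "x \<in> closure C"
      by (intro weak_limit_in_closure_cone[OF _ weak]) auto
    then obtain c where c: "\<And>j. c j \<in> C" "c \<longlonglongrightarrow> x"
      unfolding closure_sequential by blast
    have "(\<lambda>j. norm \<bar>c j - x\<bar>) \<longlonglongrightarrow> 0"
      unfolding norm_abs_eq by (rule tendsto_norm_zero[OF LIM_zero[OF c(2)]])
    then have "(\<lambda>j. \<bar>c j - x\<bar>) \<longlonglongrightarrow> 0" by (rule tendsto_norm_zero_cancel)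
    from tendsto_phi[OF this] have c_phi: "(\<lambda>j. \<phi> \<bar>c j - x\<bar>) \<longlonglongrightarrow> 0"
      by (simp only: linear_0[OF phi_linear])
    show ?thesis
    proof (rule LIMSEQ_I)
      fix \<epsilon> :: real assume \<epsilon>: "0 < \<epsilon>"
      then have "eventually (\<lambda>j. \<phi> \<bar>c j - x\<bar> < \<epsilon> / 2) sequentially"
        by (intro order_tendstoD(2)[OF c_phi]) simp
      then obtain j where j: "\<phi> \<bar>c j - x\<bar> < \<epsilon> / 2"
        using eventually_happens'[OF sequentially_bot] by blast
      obtain n where n: "1 \<le> n" "E n (c j) = c j" using c(1)[of j] by (auto simp: C_def)
      have "norm (\<phi> \<bar>E m x - x\<bar> - 0) < \<epsilon>" if m: "n \<le> m" for m
      proof -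
        have m1: "1 \<le> m" using n m by simp
        have "E m x - x = E m (x - c j) + (c j - x)"
          by (simp add: E_diff[OF m1] stable[OF n(1) m n(2)])
        then have "\<phi> \<bar>E m x - x\<bar> \<le> \<phi> \<bar>E m (x - c j)\<bar> + \<phi> \<bar>c j - x\<bar>"
          by (simp only: phi_abs_triangle)
        also have "\<dots> \<le> \<phi> \<bar>c j - x\<bar> + \<phi> \<bar>c j - x\<bar>"
          using phi_abs_E_le[OF m1, of "x - c j"] by (simp add: abs_minus_commute)
        finally show ?thesis using j phi_nonneg[of "\<bar>E m x - x\<bar>"] by simp
      qed
      then show "\<exists>n. \<forall>m\<ge>n. norm (\<phi> \<bar>E m x - x\<bar> - 0) < \<epsilon>" by blast
    qed
  qed
  have phi_mono_z: "\<phi> (z n) \<le> \<phi> (z m)" if "1 \<le> n" "n \<le> m" for n m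
    using phi_mono[OF submartingale_le[OF z that]] by (simp add: phi_E[OF that(1)])
  have phi_z: "(\<lambda>n. \<phi> (z n)) \<longlonglongrightarrow> \<phi> x"
  proof (rule LIMSEQ_I)
    fix \<epsilon> :: real assume \<epsilon>: "0 < \<epsilon>"
    have "(\<lambda>k. \<phi> (z (r k))) \<longlonglongrightarrow> \<phi> x"
      using weak phi_bounded by (simp add: weakly_converges_def)
    then have "eventually (\<lambda>k. \<phi> x - \<epsilon> < \<phi> (z (r k))) sequentially"
      using \<epsilon> by (intro order_tendstoD(1)) auto
    then obtain k where k: "\<phi> x - \<epsilon> < \<phi> (z (r k))"
      using eventually_happens'[OF sequentially_bot] by blast
    have "norm (\<phi> (z m) - \<phi> x) < \<epsilon>" if m: "r k \<le> m" for m
    proof -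
      have m1: "1 \<le> m" using r1[of k] m by simp
      have "\<phi> (z m) \<le> \<phi> x" using phi_mono[OF z_le[OF m1]] by (simp add: phi_E[OF m1])
      then show ?thesis using phi_mono_z[OF r1[of k] m] k by simp
    qed
    then show "\<exists>n. \<forall>m\<ge>n. norm (\<phi> (z m) - \<phi> x) < \<epsilon>" by blast
  qed
  have L1: "(\<lambda>n. \<phi> \<bar>z n - x\<bar>) \<longlonglongrightarrow> 0"
  proof (rule tendsto_sandwich[OF _ _ tendsto_const])
    show "(\<lambda>n. (\<phi> x - \<phi> (z n)) + \<phi> \<bar>E n x - x\<bar>) \<longlonglongrightarrow> 0"
      using tendsto_add[OF tendsto_diff[OF tendsto_const phi_z] E_x, of "\<phi> x"] by simp
    show "eventually (\<lambda>n. 0 \<le> \<phi> \<bar>z n - x\<bar>) sequentially" by (simp add: phi_nonneg)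
    show "eventually (\<lambda>n. \<phi> \<bar>z n - x\<bar> \<le> (\<phi> x - \<phi> (z n)) + \<phi> \<bar>E n x - x\<bar>) sequentially"
      using eventually_ge_at_top[of 1]
    proof eventually_elim
      case (elim n)
      have "\<bar>z n - E n x\<bar> = E n x - z n"
        using z_le[OF elim] by (subst abs_minus_commute) simp
      then show ?case
        using phi_abs_triangle[of "z n - E n x" "E n x - x"] by (simp add: phi_diff phi_E[OF elim])
    qed
  qed
  have "\<bar>- z m - - z n\<bar> = \<bar>z m - z n\<bar>" for m n
    using abs_minus_cancel[of "z m - z n"] by simp
  then have "unit_cauchy (\<lambda>n. - z n)"
    using L1_cauchy_of_L1_limit[OF L1]
    by (intro unit_cauchy_of_L1_cauchy supermartingale_minus[OF z]) (simp only:)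
  from unit_cauchy_minus[OF this] have "unit_cauchy z" by simp
  then show ?thesis
    using unit_limit_of_L1_limit[OF _ L1] uo_converges_of_unit_limit by blast
qed

end

theorem proposition5p10:
  fixes E :: "nat \<Rightarrow> 'a::banach_lattice \<Rightarrow> 'a" and z :: "nat \<Rightarrow> 'a"
  assumes "order_continuous_norm TYPE('a)"
    and "filtration E"
    and "abstract_bistochastic E"
    and "submartingale E z"
  shows "(KB_space TYPE('a) \<and> bdd_above ((\<lambda>n. norm (z n)) ` {1..})
            \<longrightarrow> (\<exists>x. uo_converges z x sequentially)) \<and>
         (\<forall>r x. strict_mono r \<and> 1 \<le> r 0 \<and> weakly_converges (\<lambda>k. z (r k)) x sequentially
            \<longrightarrow> uo_converges z x sequentially)"
proof -
  obtain e :: 'a and \<phi> :: "'a \<Rightarrow> real" where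
    "weak_unit e" "bounded_linear \<phi>" "strictly_positive \<phi>" "E 1 e = e" "\<phi> \<circ> E 1 = \<phi>"
    using assms(3) unfolding abstract_bistochastic_def by blast
  then interpret bistochastic_filtration E e \<phi>
    using assms(1,2) by (intro bistochastic_filtration.intro)
  show ?thesis
  proof (intro conjI impI allI)
    assume *: "KB_space TYPE('a) \<and> bdd_above ((\<lambda>n. norm (z n)) ` {1..})"
    then obtain C where "\<forall>y\<in>(\<lambda>n. norm (z n)) ` {1..}. y \<le> C"
      unfolding bdd_above_def by blast
    then have "norm (z n) \<le> C" if "1 \<le> n" for n
      using that by auto
    with * show "\<exists>x. uo_converges z x sequentially"
      using norm_bounded_submartingale_uo_converges[OF _ assms(4)] by blast
  next
    fix r x
    assume "strict_mono r \<and> 1 \<le> r 0 \<and> weakly_converges (\<lambda>k. z (r k)) x sequentially"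
    then show "uo_converges z x sequentially"
      using weakly_convergent_submartingale_uo_converges[OF assms(4)] by blast
  qed
qed

end
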